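(* Let $\mathcal{E}_{k,\delta}:=\mathbb{P}\big(L(\mathcal{A}(z_1,\ldots,z_k))>\min_{\theta\in\Theta}L(\theta)+\delta\big)$ be the excess risk tail of the base learner $\mathcal{A}$, and let $$T_k(t):=\mathbb{P}\Big(\sup_{\theta\in\Theta}\Big|\frac1k\sum_{i=1}^k l(\theta,z_i)-L(\theta)\Big|>t\Big).$$ (i) (ROVEs, i.e. with data splitting; general $\Theta$.) There are universal constants $C_1,\ldots,C_7>0$ such that the following holds. For every $\delta>0$, if $\epsilon$ is chosen such that $\mathbb{P}(\epsilon\in[\underline\epsilon,\overline\epsilon])=1$ for some $0<\underline\epsilon\le\overline\epsilon<\delta$ and $T_{k_2}\big((\delta-\overline\epsilon)/2\big)+T_{k_2}\big(\underline\epsilon/2\big)<1/5$, then the output $\hat\theta_n$ of ROVEs satisfies $$ \begin{aligned} \mathbb{P}\Big(L(\hat\theta_n)>\min_{\theta\in\Theta}L(\theta)+2\delta\Big)\le\ & B_1\Big[3\min\Big\{e^{-2/5},\,C_1T_{k_2}\Big(\frac{\min\{\underline\epsilon,\delta-\overline\epsilon\}}{2}\Big)\Big\}^{\frac{n}{2C_2k_2}}+e^{-B_2/C_3}\Big]\\ &+\min\Big\{e^{-(1-\mathcal{E}_{k_1,\delta})/C_4},\,C_5\mathcal{E}_{k_1,\delta}\Big\}^{\frac{n}{2C_6k_1}}+e^{-B_1(1-\mathcal{E}_{k_1,\delta})/C_7}. \end{aligned} $$ (ii) (ROVE, i.e. without data splitting.) Let $\Theta$ be finite (discrete) and assume $\lim_{k\to\infty}T_k(\delta)=0$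 for all $\delta>0$. Then for every fixed $\delta>0$, the output $\hat\theta_n$ of ROVE satisfies $$\lim_{n\to\infty}\mathbb{P}\Big(L(\hat\theta_n)>\min_{\theta\in\Theta}L(\theta)+2\delta\Big)=0,$$ provided that $\limsup_{k\to\infty}\mathcal{E}_{k,\delta}<1$ and, as $n\to\infty$, $\mathbb{P}(\epsilon>\delta/2)\to0$, $k_1,k_2\to\infty$, $n/k_1,n/k_2\to\infty$, and $B_1,B_2\to\infty$.
   Context: Setting: $z$ is a random variable with values in $\mathcal{Z}$, $l:\Theta\times\mathcal{Z}\to\mathbb{R}$ a cost function, $L(\theta):=\mathbb{E}[l(\theta,z)]$, and $z_1,\ldots,z_n$ are i.i.d. copies of $z$. The minimum of $L$ over $\Theta$ is assumed to exist. Base learner: $\mathcal{A}(z_1,\ldots,z_k;\omega)\in\Theta$ is a learning algorithm mapping data (of any size) and algorithmic randomness $\omega$, independent of the data, to an element of $\Theta$; $\omega$ is suppressed. The probability in $\mathcal{E}_{k,\delta}$ is over $k$ i.i.d. observations and $\omega$. Algorithm ROVE / ROVEs: inputs are $\mathcal{A}$, the data $(z_1,\ldots,z_n)$, subsample sizes $k_1,k_2$ (less than $n$ without splitting, at most $n/2$ with splitting), ensemble sizes $B_1,B_2$. Without data splitting (ROVE) both phases use all data $D_1=D_2=(z_1,\ldots,z_n)$; with data splitting (ROVEs) Phase I uses $D_1=(z_1,\ldots,z_{\lfloor n/2\rfloor})$ and Phase II uses $D_2=(z_{\lfloor n/2\rfloor+1},\ldots,z_n)$. Phase I: for $b=1,\ldots,B_1$,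 independently draw $(z_1^b,\ldots,z_{k_1}^b)$ uniformly from $D_1$ without replacement and set $\hat\theta_{k_1}^b=\mathcal{A}(z_1^b,\ldots,z_{k_1}^b)$ (independent algorithmic randomness for each $b$). Let $\mathcal{S}=\{\hat\theta^b_{k_1}:b=1,\ldots,B_1\}$. Phase II: choose a (possibly data-dependent, random) threshold $\epsilon\ge0$ using the data $D_1$. For $b=1,\ldots,B_2$, independently draw $(z_1^b,\ldots,z_{k_2}^b)$ uniformly from $D_2$ without replacement and compute $$\widehat\Theta_{k_2}^{\epsilon,b}:=\Big\{\theta\in\mathcal{S}:\frac1{k_2}\sum_{i=1}^{k_2}l(\theta,z_i^b)\le\min_{\theta'\in\mathcal{S}}\frac1{k_2}\sum_{i=1}^{k_2}l(\theta',z_i^b)+\epsilon\Big\}.$$ Output: $\hat\theta_n\in\arg\max_{\theta\in\mathcal{S}}\sum_{b=1}^{B_2}\mathbf{1}(\theta\in\widehat\Theta_{k_2}^{\epsilon,b})$, ties broken arbitrarily. "Universal constants" means absolute numerical constants, independent of all problem data and parameters. *)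

theory Defs
  imports "HOL-Probability.Probability"
begin

text \<open>
  A sample of size \<open>k\<close> is a function on \<open>{..<k}\<close>, with law \<open>PiM {..<k} (\<lambda>_. P)\<close>
  when its entries are i.i.d. copies of \<open>z\<close>, where \<open>P\<close> is the law of \<open>z\<close>.
\<close>

definition risk :: "'z measure \<Rightarrow> ('t \<Rightarrow> 'z \<Rightarrow> real) \<Rightarrow> 't \<Rightarrow> real" where
  "risk P l \<theta> = (\<integral>z. l \<theta> z \<partial>P)"

definition min_risk :: "'z measure \<Rightarrow> ('t \<Rightarrow> 'z \<Rightarrow> real) \<Rightarrow> 't set \<Rightarrow> real" where
  "min_risk P l \<Theta> = (INF \<theta>\<in>\<Theta>. risk P l \<theta>)"

definition emp_risk :: "('t \<Rightarrow> 'z \<Rightarrow> real) \<Rightarrow> nat \<Rightarrow> (nat \<Rightarrow> 'z) \<Rightarrow> 't \<Rightarrow> real" where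
  "emp_risk l k v \<theta> = (1 / real k) * (\<Sum>i<k. l \<theta> (v i))"

text \<open>The supremum is taken in the extended reals because it may be infinite.\<close>

definition sup_dev ::
    "'z measure \<Rightarrow> ('t \<Rightarrow> 'z \<Rightarrow> real) \<Rightarrow> 't set \<Rightarrow> nat \<Rightarrow> (nat \<Rightarrow> 'z) \<Rightarrow> ereal" where
  "sup_dev P l \<Theta> k v = (SUP \<theta>\<in>\<Theta>. ereal \<bar>emp_risk l k v \<theta> - risk P l \<theta>\<bar>)"

definition dev_tail ::
    "'z measure \<Rightarrow> ('t \<Rightarrow> 'z \<Rightarrow> real) \<Rightarrow> 't set \<Rightarrow> nat \<Rightarrow> real \<Rightarrow> real" where
  "dev_tail P l \<Theta> k t = \<P>(v in PiM {..<k} (\<lambda>_. P). sup_dev P l \<Theta> k v > ereal t)"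

text \<open>\<open>A k v \<omega>\<close> is the base learner run on the sample \<open>v\<close> of size \<open>k\<close> with algorithmic
  randomness \<open>\<omega>\<close>, whose law is \<open>Q\<close>.\<close>

definition excess_tail ::
    "'z measure \<Rightarrow> ('t \<Rightarrow> 'z \<Rightarrow> real) \<Rightarrow> 't set \<Rightarrow> 'w measure
      \<Rightarrow> (nat \<Rightarrow> (nat \<Rightarrow> 'z) \<Rightarrow> 'w \<Rightarrow> 't) \<Rightarrow> nat \<Rightarrow> real \<Rightarrow> real" where
  "excess_tail P l \<Theta> Q A k \<delta> =
    \<P>(x in PiM {..<k} (\<lambda>_. P) \<Otimes>\<^sub>M Q.
        risk P l (A k (fst x) (snd x)) > min_risk P l \<Theta> + \<delta>)"

text \<open>The parameter space is \<open>space Th\<close>; its sigma-algebra only serves to make the learner's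
  output a random element.\<close>

locale learning_setting =
  P: prob_space P + Q: prob_space Q
  for P :: "'z measure" and Q :: "'w measure" +
  fixes Th :: "'t measure"
    and l :: "'t \<Rightarrow> 'z \<Rightarrow> real"
    and A :: "nat \<Rightarrow> (nat \<Rightarrow> 'z) \<Rightarrow> 'w \<Rightarrow> 't"
  assumes loss_measurable: "(\<lambda>(\<theta>, z). l \<theta> z) \<in> borel_measurable (Th \<Otimes>\<^sub>M P)"
    and loss_integrable: "\<And>\<theta>. \<theta> \<in> space Th \<Longrightarrow> integrable P (l \<theta>)"
    and min_attained: "\<exists>\<theta>\<^sub>0\<in>space Th. \<forall>\<theta>\<in>space Th. risk P l \<theta>\<^sub>0 \<le> risk P l \<theta>"
    and learner_measurable:
      "\<And>k. 0 < k \<Longrightarrow> (\<lambda>(v, \<omega>). A k v \<omega>) \<in> (PiM {..<k} (\<lambda>_. P) \<Otimes>\<^sub>M Q) \<rightarrow>\<^sub>M Th"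

text \<open>
  The flag \<open>sp\<close> says whether the data are split (ROVEs) or not (ROVE).  Data points are
  indexed from \<open>0\<close>.
\<close>

definition phase1_idx :: "bool \<Rightarrow> nat \<Rightarrow> nat set" where
  "phase1_idx sp n = (if sp then {..<n div 2} else {..<n})"

definition phase2_idx :: "bool \<Rightarrow> nat \<Rightarrow> nat set" where
  "phase2_idx sp n = (if sp then {n div 2..<n} else {..<n})"

definition subsample_size_ok :: "bool \<Rightarrow> nat \<Rightarrow> nat \<Rightarrow> bool" where
  "subsample_size_ok sp n k \<longleftrightarrow> 0 < k \<and> (if sp then 2 * k \<le> n else k < n)"

text \<open>Drawing \<open>k\<close> positions from \<open>D\<close> without replacement: a uniform injective \<open>k\<close>-tuple.\<close>

definition draw :: "nat \<Rightarrow> nat set \<Rightarrow> (nat \<Rightarrow> nat) measure" where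
  "draw k D = uniform_count_measure {f \<in> {..<k} \<rightarrow>\<^sub>E D. inj_on f {..<k}}"

definition subsample :: "nat \<Rightarrow> (nat \<Rightarrow> 'z) \<Rightarrow> (nat \<Rightarrow> nat) \<Rightarrow> (nat \<Rightarrow> 'z)" where
  "subsample k v f = (\<lambda>i\<in>{..<k}. v (f i))"

definition candidates ::
    "(nat \<Rightarrow> (nat \<Rightarrow> 'z) \<Rightarrow> 'w \<Rightarrow> 't) \<Rightarrow> nat \<Rightarrow> nat \<Rightarrow> (nat \<Rightarrow> 'z) \<Rightarrow> (nat \<Rightarrow> 'w)
      \<Rightarrow> (nat \<Rightarrow> nat \<Rightarrow> nat) \<Rightarrow> 't set" where
  "candidates A k1 B1 v \<omega> f = (\<lambda>b. A k1 (subsample k1 v (f b)) (\<omega> b)) ` {..<B1}"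

definition near_optimal ::
    "('t \<Rightarrow> 'z \<Rightarrow> real) \<Rightarrow> nat \<Rightarrow> (nat \<Rightarrow> 'z) \<Rightarrow> 't set \<Rightarrow> real \<Rightarrow> 't set" where
  "near_optimal l k v S e =
    {\<theta> \<in> S. emp_risk l k v \<theta> \<le> Min (emp_risk l k v ` S) + e}"

definition votes ::
    "('t \<Rightarrow> 'z \<Rightarrow> real) \<Rightarrow> nat \<Rightarrow> nat \<Rightarrow> (nat \<Rightarrow> 'z) \<Rightarrow> (nat \<Rightarrow> nat \<Rightarrow> nat)
      \<Rightarrow> 't set \<Rightarrow> real \<Rightarrow> 't \<Rightarrow> nat" where
  "votes l k2 B2 v g S e \<theta> =
    (\<Sum>b<B2. of_bool (\<theta> \<in> near_optimal l k2 (subsample k2 v (g b)) S e))"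

text \<open>
  All randomness of one run except the threshold and the tie-breaking: the data, the
  \<open>B1\<close> seeds of the learner and the index tuples drawn in the two phases.  Being a product,
  this law makes all these components independent.
\<close>

definition run_law ::
    "bool \<Rightarrow> 'z measure \<Rightarrow> 'w measure \<Rightarrow> nat \<Rightarrow> nat \<Rightarrow> nat \<Rightarrow> nat \<Rightarrow> nat
      \<Rightarrow> ((nat \<Rightarrow> 'z) \<times> (nat \<Rightarrow> 'w) \<times> (nat \<Rightarrow> nat \<Rightarrow> nat) \<times> (nat \<Rightarrow> nat \<Rightarrow> nat)) measure" where
  "run_law sp P Q n k1 k2 B1 B2 =
    PiM {..<n} (\<lambda>_. P) \<Otimes>\<^sub>M PiM {..<B1} (\<lambda>_. Q) \<Otimes>\<^sub>M
    PiM {..<B1} (\<lambda>_. draw k1 (phase1_idx sp n)) \<Otimes>\<^sub>M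
    PiM {..<B2} (\<lambda>_. draw k2 (phase2_idx sp n))"

text \<open>
  A run of the algorithm on an arbitrary probability space \<open>M\<close>.  The threshold may depend on
  the Phase I data, on everything computed in Phase I and on extra randomness, but not on the
  remaining data or on the Phase II draws: this is \<open>threshold_indep\<close>.  The output is any
  random element that lies in the argmax, so ties may be broken in any way.
\<close>

locale rove_run =
  learning_setting P Q Th l A + M: prob_space M
  for P :: "'z measure" and Q :: "'w measure" and Th :: "'t measure"
    and l :: "'t \<Rightarrow> 'z \<Rightarrow> real" and A :: "nat \<Rightarrow> (nat \<Rightarrow> 'z) \<Rightarrow> 'w \<Rightarrow> 't"
    and M :: "'m measure" +
  fixes sp :: bool and n k1 k2 B1 B2 :: nat
    and data :: "'m \<Rightarrow> nat \<Rightarrow> 'z"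
    and seed :: "'m \<Rightarrow> nat \<Rightarrow> 'w"
    and draw1 draw2 :: "'m \<Rightarrow> nat \<Rightarrow> nat \<Rightarrow> nat"
    and eps :: "'m \<Rightarrow> real"
    and out :: "'m \<Rightarrow> 't"
  assumes sizes: "subsample_size_ok sp n k1" "subsample_size_ok sp n k2" "0 < B1" "0 < B2"
    and randomness_measurable:
      "(\<lambda>x. (data x, seed x, draw1 x, draw2 x)) \<in> M \<rightarrow>\<^sub>M run_law sp P Q n k1 k2 B1 B2"
    and randomness_law:
      "distr M (run_law sp P Q n k1 k2 B1 B2) (\<lambda>x. (data x, seed x, draw1 x, draw2 x))
        = run_law sp P Q n k1 k2 B1 B2"
    and threshold_measurable: "eps \<in> borel_measurable M"
    and threshold_nonneg: "\<And>x. x \<in> space M \<Longrightarrow> 0 \<le> eps x"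
    and threshold_indep:
      "M.indep_set
        (sets (vimage_algebra (space M)
          (\<lambda>x. (restrict (data x) (phase1_idx sp n), seed x, draw1 x, eps x))
          (PiM (phase1_idx sp n) (\<lambda>_. P) \<Otimes>\<^sub>M PiM {..<B1} (\<lambda>_. Q) \<Otimes>\<^sub>M
           PiM {..<B1} (\<lambda>_. draw k1 (phase1_idx sp n)) \<Otimes>\<^sub>M borel)))
        (sets (vimage_algebra (space M)
          (\<lambda>x. (restrict (data x) ({..<n} - phase1_idx sp n), draw2 x))
          (PiM ({..<n} - phase1_idx sp n) (\<lambda>_. P) \<Otimes>\<^sub>M
           PiM {..<B2} (\<lambda>_. draw k2 (phase2_idx sp n)))))"
    and output_measurable: "out \<in> M \<rightarrow>\<^sub>M Th"
    and output_argmax: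
      "\<And>x. x \<in> space M \<Longrightarrow>
        is_arg_max
          (votes l k2 B2 (data x) (draw2 x)
            (candidates A k1 B1 (data x) (seed x) (draw1 x)) (eps x))
          (\<lambda>\<theta>. \<theta> \<in> candidates A k1 B1 (data x) (seed x) (draw1 x))
          (out x)"

text \<open>
  Type variables are quantified outside of every formula, so constants that merely exist might
  depend on the types of the data, the parameters and the randomness.  A fixed numeral as upper
  limit excludes this: \<open>roves_bound\<close> below is nondecreasing in each constant, so if for every
  choice of types there are suitable constants up to \<open>1000\<close>, then taking all of them equal to
  \<open>1000\<close> is suitable for all types at once.
\<close>

definition universal_constants :: "real set \<Rightarrow> bool" where
  "universal_constants K \<longleftrightarrow> (\<forall>C\<in>K. 0 < C \<and> C \<le> 1000)"

text \<open>\<open>E\<close> stands for the excess risk tail of the base learner and \<open>\<tau>\<close> for the tail of the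
  uniform deviation.\<close>

definition roves_bound ::
    "real \<Rightarrow> real \<Rightarrow> real \<Rightarrow> real \<Rightarrow> real \<Rightarrow> real \<Rightarrow> real
      \<Rightarrow> nat \<Rightarrow> nat \<Rightarrow> nat \<Rightarrow> nat \<Rightarrow> nat \<Rightarrow> real \<Rightarrow> real \<Rightarrow> real" where
  "roves_bound C1 C2 C3 C4 C5 C6 C7 n k1 k2 B1 B2 E \<tau> =
    real B1 *
      (3 * min (exp (- 2 / 5)) (C1 * \<tau>) powr (real n / (2 * C2 * real k2))
       + exp (- real B2 / C3))
    + min (exp (- (1 - E) / C4)) (C5 * E) powr (real n / (2 * C6 * real k1))
    + exp (- real B1 * (1 - E) / C7)"

end

theory Submission
  imports Defs
begin

text \<open>
  Fix \<open>t\<close> and call a Phase II subsample deviating if on it some empirical risk is off by more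
  than \<open>t\<close>.  If \<open>2 t + \<epsilon> \<le> \<delta>\<close>, then a subsample that does not deviate gives no vote to a
  candidate whose risk exceeds that of another candidate by more than \<open>\<delta>\<close>.  If moreover
  \<open>2 t \<le> \<epsilon>\<close>, it votes for every candidate of smallest risk.  With
  \<open>t = min {el, \<delta> - eu} / 2\<close> both hold, so a winner that is worse than some candidate by more
  than \<open>\<delta>\<close> forces at least half of the \<open>B2\<close> subsamples to deviate
  (\<open>far_winner_imp_deviating\<close>).  Hence an output with excess risk above \<open>2 \<delta>\<close> leaves two
  possibilities (\<open>bad_output_imp\<close>): all Phase I candidates have excess risk above \<open>\<delta>\<close>, or half of
  the Phase II subsamples deviate.  Deviation is uniform over the parameter space, so the second
  event does not mention the candidates or the threshold, and there is one such event rather than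
  one for each candidate.

  Both events have the same structure.  Given the data, the draws are independent and a single
  draw is bad with probability \<open>U\<close>, the average of a function \<open>h\<close> with values in \<open>[0, 1]\<close> over all
  subsamples of size \<open>k\<close>: a U-statistic whose mean is \<open>E = excess_tail\<close> in Phase I and
  \<open>\<tau> = dev_tail\<close> in Phase II.  So all \<open>B1\<close> draws are bad with conditional probability \<open>U ^ B1\<close>,
  which is small unless \<open>U > (1 + E) / 2\<close>, and half of the \<open>B2\<close> draws are bad with a probability
  exponentially small in \<open>B2\<close> unless \<open>U \<ge> 1 / 3\<close>.  What remains is Hoeffding's bound for
  U-statistics (\<open>u_stat_tail\<close>): \<open>U\<close> is an average, over permutations of the data, of
  means over \<open>q\<close> disjoint blocks of length \<open>k\<close>, so by convexity its exponential moments are at most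
  those of a mean of \<open>q\<close> independent copies of \<open>h\<close>.  This gives
  \<open>P (U \<ge> u) \<le> ((1 + \<tau> (z - 1)) / z powr u) ^ q\<close> for every \<open>z \<ge> 1\<close>.  The choice \<open>z = 2\<close> serves means
  of moderate size, and \<open>z = 1 / \<tau>\<close> gives the rate that vanishes with \<open>\<tau>\<close>.

  For finite parameter spaces the threshold may be 0, and then several optimal candidates may share
  the votes.  Still every subsample votes for at least one candidate, so the winner has
  the votes of at least a fraction \<open>1 / N\<close> of the subsamples, where \<open>N\<close> is the number of
  parameters, and a bad winner with \<open>t = \<delta> / 4\<close> forces a fraction \<open>1 / N\<close> of the subsamples to
  deviate.  By Markov's inequality this has probability at most \<open>N\<close> times \<open>dev_tail\<close>, which tends to 0.
\<close>

section \<open>Subsamples and U-statistics\<close>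

definition injections :: "nat \<Rightarrow> nat set \<Rightarrow> (nat \<Rightarrow> nat) set" where
  "injections k D = {f \<in> {..<k} \<rightarrow>\<^sub>E D. inj_on f {..<k}}"

definition u_stat :: "nat \<Rightarrow> nat set \<Rightarrow> ((nat \<Rightarrow> 'z) \<Rightarrow> real) \<Rightarrow> (nat \<Rightarrow> 'z) \<Rightarrow> real" where
  "u_stat k D h v = (\<Sum>f\<in>injections k D. h (subsample k v f)) / card (injections k D)"

lemma finite_injections: "finite D \<Longrightarrow> finite (injections k D)"
  unfolding injections_def by (simp add: finite_PiE)

lemma injections_nonempty:
  assumes "finite D" "k \<le> card D"
  shows "injections k D \<noteq> {}"
proof -
  obtain e where "inj_on e {..<k}" "e ` {..<k} \<subseteq> D"
    using card_le_inj[of "{..<k}" D] assms by auto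
  then have "restrict e {..<k} \<in> injections k D"
    unfolding injections_def by (auto simp: inj_on_def)
  then show ?thesis by blast
qed

lemma injections_range:
  assumes "f \<in> injections k D" "i < k"
  shows "f i \<in> D"
  using assms unfolding injections_def by auto

text \<open>
  Match the two images along the injections.  Their complements in \<open>D\<close> have equal size, so any
  bijection between them completes the permutation.
\<close>

lemma permutation_between_injections:
  assumes D: "finite D" and f: "f \<in> injections k D" and f': "f' \<in> injections k D"
  obtains \<rho> where "\<rho> permutes D" "\<And>i. i < k \<Longrightarrow> \<rho> (f i) = f' i"
proof -
  define A where "A = f ` {..<k}"
  define B where "B = f' ` {..<k}"
  have inj: "inj_on f {..<k}" "inj_on f' {..<k}" and sub: "A \<subseteq> D" "B \<subseteq> D"
    using f f' unfolding injections_def A_def B_def by auto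
  have fin: "finite A" "finite B" unfolding A_def B_def by auto
  have "card (D - A) = card (D - B)"
    using inj sub fin by (simp add: card_Diff_subset A_def B_def card_image)
  then obtain c where c: "bij_betw c (D - A) (D - B)"
    using D by (meson finite_Diff finite_same_card_bij)
  define a where "a = f' \<circ> the_inv_into {..<k} f"
  have a: "bij_betw a A B"
    unfolding a_def A_def B_def
    by (intro bij_betw_trans[of _ _ "{..<k}"] bij_betw_the_inv_into inj_on_imp_bij_betw inj)
  define \<rho> where "\<rho> = (\<lambda>x. if x \<in> A then a x else if x \<in> D then c x else x)"
  have 1: "bij_betw \<rho> A B" using a by (rule bij_betw_cong[THEN iffD1, rotated]) (simp add: \<rho>_def)
  have 2: "bij_betw \<rho> (D - A) (D - B)"
    using c by (rule bij_betw_cong[THEN iffD1, rotated]) (simp add: \<rho>_def)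
  have "bij_betw \<rho> (A \<union> (D - A)) (B \<union> (D - B))"
    by (rule bij_betw_combine[OF 1 2]) auto
  then have "bij_betw \<rho> D D" using sub by (simp add: Un_absorb1)
  then have "\<rho> permutes D"
    by (rule bij_imp_permutes) (use sub in \<open>auto simp: \<rho>_def\<close>)
  moreover have "\<rho> (f i) = f' i" if "i < k" for i
    using that inj(1) by (simp add: \<rho>_def A_def a_def the_inv_into_f_f)
  ultimately show thesis using that by blast
qed

text \<open>
  This is the combinatorial half of Hoeffding's representation: a fixed subsample moved by a uniform
  permutation is a uniform subsample.  The sum over permutations does not depend on \<open>f\<close>, because
  \<open>f\<close> can be traded for any other injection by a right translation; averaging over all \<open>f\<close>
  and reindexing by \<open>\<pi>\<close> gives the value.
\<close>

lemma sum_permuted_injection: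
  fixes F :: "(nat \<Rightarrow> nat) \<Rightarrow> real"
  assumes D: "finite D" and f: "f \<in> injections k D"
  shows "card (injections k D) * (\<Sum>\<pi> | \<pi> permutes D. F (\<lambda>i\<in>{..<k}. \<pi> (f i)))
    = card {\<pi>. \<pi> permutes D} * (\<Sum>g\<in>injections k D. F g)"
proof -
  define c where "c g = (\<Sum>\<pi> | \<pi> permutes D. F (\<lambda>i\<in>{..<k}. \<pi> (g i)))" for g
  have const: "c g = c f" if g: "g \<in> injections k D" for g
  proof -
    obtain \<rho> where \<rho>: "\<rho> permutes D" "\<And>i. i < k \<Longrightarrow> \<rho> (f i) = g i"
      using permutation_between_injections[OF D f g] by blast
    have "c f = (\<Sum>\<pi> | \<pi> permutes D. F (\<lambda>i\<in>{..<k}. (\<pi> \<circ> \<rho>) (f i)))"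
      unfolding c_def by (rule sum_permutations_compose_right[OF \<rho>(1)])
    also have "\<dots> = c g"
      unfolding c_def by (intro sum.cong refl arg_cong[where f=F]) (auto simp: \<rho>(2) restrict_def)
    finally show ?thesis by simp
  qed
  have "card (injections k D) * c f = (\<Sum>g\<in>injections k D. c g)"
    by (simp add: const)
  also have "\<dots> = (\<Sum>\<pi> | \<pi> permutes D. \<Sum>g\<in>injections k D. F (\<lambda>i\<in>{..<k}. \<pi> (g i)))"
    unfolding c_def by (rule sum.swap)
  also have "\<dots> = (\<Sum>\<pi> | \<pi> permutes D. \<Sum>g\<in>injections k D. F g)"
  proof (rule sum.cong[OF refl])
    fix \<pi> assume "\<pi> \<in> {\<pi>. \<pi> permutes D}"
    then have \<pi>: "\<pi> permutes D" by simp
    note perm = permutes_inverses[OF \<pi>] permutes_in_image[OF \<pi>]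
      permutes_in_image[OF permutes_inv[OF \<pi>]]
    have stable: "(\<lambda>i\<in>{..<k}. \<sigma> (g i)) \<in> injections k D"
      if "\<sigma> permutes D" "g \<in> injections k D" for \<sigma> g
      using that permutes_in_image[OF that(1)] permutes_inj[OF that(1)]
      unfolding injections_def by (auto simp: inj_on_def)
    show "(\<Sum>g\<in>injections k D. F (\<lambda>i\<in>{..<k}. \<pi> (g i))) = (\<Sum>g\<in>injections k D. F g)"
    proof (rule sum.reindex_bij_witness[where i="\<lambda>g. \<lambda>i\<in>{..<k}. inv \<pi> (g i)"
          and j="\<lambda>g. \<lambda>i\<in>{..<k}. \<pi> (g i)"])
      fix g assume g: "g \<in> injections k D"
      then have ext: "g i = undefined" if "\<not> i < k" for i
        using that unfolding injections_def by (auto simp: PiE_def extensional_def)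
      show "(\<lambda>i\<in>{..<k}. inv \<pi> ((\<lambda>i\<in>{..<k}. \<pi> (g i)) i)) = g"
        "(\<lambda>i\<in>{..<k}. \<pi> ((\<lambda>i\<in>{..<k}. inv \<pi> (g i)) i)) = g"
        by (auto simp: restrict_def perm ext)
      show "(\<lambda>i\<in>{..<k}. \<pi> (g i)) \<in> injections k D" "(\<lambda>i\<in>{..<k}. inv \<pi> (g i)) \<in> injections k D"
        using stable[OF \<pi> g] stable[OF permutes_inv[OF \<pi>] g] by auto
    qed auto
  qed
  finally show ?thesis unfolding c_def by simp
qed

lemma measurable_subsample:
  assumes "\<And>i. i < k \<Longrightarrow> f i \<in> I"
  shows "(\<lambda>v. subsample k v f) \<in> PiM I (\<lambda>_. M) \<rightarrow>\<^sub>M PiM {..<k} (\<lambda>_. M)"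
  unfolding subsample_def using assms by (intro measurable_restrict measurable_component_singleton) auto

lemma (in prob_space) distr_subsample:
  assumes "inj_on f {..<k}" "\<And>i. i < k \<Longrightarrow> f i \<in> I"
  shows "distr (PiM I (\<lambda>_. M)) (PiM {..<k} (\<lambda>_. M)) (\<lambda>v. subsample k v f) = PiM {..<k} (\<lambda>_. M)"
  unfolding subsample_def
  by (rule distr_PiM_reindex) (use assms prob_space_axioms in auto)

text \<open>
  Disjoint index blocks of an i.i.d. sample are independent, and each block is itself a sample of
  size \<open>k\<close>.
\<close>

lemma (in prob_space) expectation_prod_blocks:
  fixes \<phi> :: "(nat \<Rightarrow> 'a) \<Rightarrow> real"
  assumes k: "0 < k" and f: "\<And>j i. j < q \<Longrightarrow> i < k \<Longrightarrow> f j i \<in> I"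
    and inj: "\<And>j. j < q \<Longrightarrow> inj_on (f j) {..<k}"
    and disj: "disjoint_family_on (\<lambda>j. f j ` {..<k}) {..<q}"
    and \<phi>: "integrable (PiM {..<k} (\<lambda>_. M)) \<phi>"
  shows "(\<integral>v. (\<Prod>j<q. \<phi> (subsample k v (f j))) \<partial>PiM I (\<lambda>_. M))
      = (\<integral>v. \<phi> v \<partial>PiM {..<k} (\<lambda>_. M)) ^ q"
    and "integrable (PiM I (\<lambda>_. M)) (\<lambda>v. \<Prod>j<q. \<phi> (subsample k v (f j)))"
proof -
  let ?N = "PiM I (\<lambda>_. M)" and ?K = "PiM {..<k} (\<lambda>_. M)"
  interpret N: prob_space ?N by (intro prob_space_PiM prob_space_axioms)
  note [measurable] = borel_measurable_integrable[OF \<phi>]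
  have sub: "(\<lambda>v. subsample k v (f j)) \<in> ?N \<rightarrow>\<^sub>M ?K" if "j < q" for j
    by (rule measurable_subsample) (use f that in auto)
  have indep: "N.indep_vars (\<lambda>_. borel) (\<lambda>j v. \<phi> (subsample k v (f j))) {..<q}" if q: "0 < q"
  proof -
    have I': "I \<noteq> {}" using q k f by auto
    have "N.indep_vars (\<lambda>_. M) (\<lambda>i v. v i) I"
    proof (subst N.indep_vars_iff_distr_eq_PiM'[OF I'])
      have "distr ?N ?N (\<lambda>x. restrict x I) = distr ?N ?N (\<lambda>x. x)"
        by (intro distr_cong) (auto simp: space_PiM)
      moreover have "PiM I (\<lambda>i. distr ?N M (\<lambda>v. v i)) = ?N"
        by (intro PiM_cong refl distr_PiM_component prob_space_axioms)
      ultimately show "distr ?N ?N (\<lambda>x. \<lambda>i\<in>I. x i) = PiM I (\<lambda>i. distr ?N M (\<lambda>v. v i))"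
        by (simp add: distr_id)
    qed auto
    then have "N.indep_vars (\<lambda>j. PiM (f j ` {..<k}) (\<lambda>_. M))
        (\<lambda>j v. restrict (\<lambda>i. v i) (f j ` {..<k})) {..<q}"
      by (rule N.indep_vars_restrict) (use f disj in auto)
    then have "N.indep_vars (\<lambda>_. borel)
        (\<lambda>j v. \<phi> (subsample k (restrict (\<lambda>i. v i) (f j ` {..<k})) (f j))) {..<q}"
    proof (rule N.indep_vars_compose2)
      fix j show "(\<lambda>v. \<phi> (subsample k v (f j))) \<in> borel_measurable (PiM (f j ` {..<k}) (\<lambda>_. M))"
        by (rule measurable_compose[OF measurable_subsample]) auto
    qed
    moreover have "subsample k (restrict (\<lambda>i. v i) (f j ` {..<k})) (f j) = subsample k v (f j)" for j and v :: "nat \<Rightarrow> 'a"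
      by (auto simp: subsample_def)
    ultimately show ?thesis by simp
  qed
  have int: "integrable ?N (\<lambda>v. \<phi> (subsample k v (f j)))" if "j < q" for j
  proof (rule integrable_distr[OF sub[OF that]])
    show "integrable (distr ?N ?K (\<lambda>v. subsample k v (f j))) \<phi>"
      using distr_subsample[of "f j" k I] inj f that \<phi> by auto
  qed
  have val: "(\<integral>v. \<phi> (subsample k v (f j)) \<partial>?N) = (\<integral>v. \<phi> v \<partial>?K)" if "j < q" for j
    using integral_distr[OF sub[OF that], of \<phi>] distr_subsample[of "f j" k I] inj f that by auto
  have "(\<integral>v. (\<Prod>j<q. \<phi> (subsample k v (f j))) \<partial>?N) = (\<integral>v. \<phi> v \<partial>?K) ^ q
      \<and> integrable ?N (\<lambda>v. \<Prod>j<q. \<phi> (subsample k v (f j)))"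
  proof (cases "q = 0")
    case False
    then have ind: "N.indep_vars (\<lambda>_. borel) (\<lambda>j v. \<phi> (subsample k v (f j))) {..<q}"
      using indep by simp
    show ?thesis
      using N.indep_vars_lebesgue_integral[OF _ ind] N.indep_vars_integrable[OF _ ind] int val
      by simp
  qed (simp add: N.prob_space)
  then show "(\<integral>v. (\<Prod>j<q. \<phi> (subsample k v (f j))) \<partial>?N) = (\<integral>v. \<phi> v \<partial>?K) ^ q"
    and "integrable ?N (\<lambda>v. \<Prod>j<q. \<phi> (subsample k v (f j)))"
    by blast+
qed

section \<open>Hoeffding's tail bound for U-statistics\<close>

text \<open>Convexity of the exponential: the chord over \<open>[0, 1]\<close> lies above the graph.\<close>

lemma powr_le_chord:
  fixes x z :: real
  assumes "0 \<le> x" "x \<le> 1" "0 < z"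
  shows "z powr x \<le> 1 + x * (z - 1)"
proof -
  have "exp ((1 - x) * 0 + x * ln z) \<le> (1 - x) * exp 0 + x * exp (ln z)"
    using convex_onD[OF exp_convex, of x 0 "ln z"] assms by simp
  then show ?thesis using assms by (simp add: powr_def algebra_simps)
qed

lemma u_stat_measurable [measurable]:
  assumes D: "D \<subseteq> I" and [measurable]: "h \<in> borel_measurable (PiM {..<k} (\<lambda>_. M))"
  shows "u_stat k D h \<in> borel_measurable (PiM I (\<lambda>_. M))"
proof -
  have "(\<lambda>v. h (subsample k v f)) \<in> borel_measurable (PiM I (\<lambda>_. M))" if "f \<in> injections k D" for f
    by (rule measurable_compose[OF measurable_subsample[where f=f]])
      (use D injections_range[OF that] in auto)
  then show ?thesis unfolding u_stat_def by (intro borel_measurable_divide borel_measurable_sum) auto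
qed

text \<open>
  Hoeffding's representation.  The injections \<open>f j\<close> are arbitrary here; it becomes useful when their
  images are disjoint, because then the inner sums have independent terms.
\<close>

lemma u_stat_eq_permutation_average:
  fixes q :: nat
  assumes D: "finite D" "k \<le> card D" and f: "\<And>j. j < q \<Longrightarrow> f j \<in> injections k D"
  shows "q * u_stat k D h v = (\<Sum>\<pi> | \<pi> permutes D.
    (1 / card {\<pi>. \<pi> permutes D}) * (\<Sum>j<q. h (subsample k v (\<lambda>i\<in>{..<k}. \<pi> (f j i)))))"
proof -
  let ?Pm = "{\<pi>. \<pi> permutes D}"
  have ci: "card (injections k D) \<noteq> 0"
    using finite_injections[OF D(1)] injections_nonempty[OF D] by simp
  have cp: "card ?Pm \<noteq> 0" using D(1) by (simp add: card_permutations)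
  have "u_stat k D h v = (1 / card ?Pm) * (\<Sum>\<pi>\<in>?Pm. h (subsample k v (\<lambda>i\<in>{..<k}. \<pi> (f j i))))"
    if "j < q" for j
    using sum_permuted_injection[OF D(1) f[OF that], of "\<lambda>g. h (subsample k v g)"] ci cp
    unfolding u_stat_def by (simp add: field_simps)
  then have "(\<Sum>j<q. u_stat k D h v)
      = (\<Sum>j<q. (1 / card ?Pm) * (\<Sum>\<pi>\<in>?Pm. h (subsample k v (\<lambda>i\<in>{..<k}. \<pi> (f j i)))))"
    by (intro sum.cong) auto
  also have "\<dots> = (\<Sum>\<pi>\<in>?Pm. (1 / card ?Pm) * (\<Sum>j<q. h (subsample k v (\<lambda>i\<in>{..<k}. \<pi> (f j i)))))"
    unfolding sum_distrib_left by (rule sum.swap)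
  finally show ?thesis by simp
qed

text \<open>
  Jensen's inequality moves the average over permutations out of the exponential; for each
  permutation the blocks are independent, and the chord bound replaces \<open>z powr h\<close> by an affine
  function of \<open>h\<close>.
\<close>

lemma (in prob_space) u_stat_mgf:
  fixes h :: "(nat \<Rightarrow> 'a) \<Rightarrow> real" and q :: nat
  assumes k: "0 < k" and D: "finite D" "D \<subseteq> I" "q * k \<le> card D" and q: "0 < q"
    and h [measurable]: "h \<in> borel_measurable (PiM {..<k} (\<lambda>_. M))"
    and h01: "\<And>v. 0 \<le> h v" "\<And>v. h v \<le> 1" and z: "1 \<le> z"
  shows "(\<integral>v. z powr (q * u_stat k D h v) \<partial>PiM I (\<lambda>_. M))
      \<le> (1 + (\<integral>v. h v \<partial>PiM {..<k} (\<lambda>_. M)) * (z - 1)) ^ q"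
    and "integrable (PiM I (\<lambda>_. M)) (\<lambda>v. z powr (q * u_stat k D h v))"
proof -
  let ?N = "PiM I (\<lambda>_. M)" and ?K = "PiM {..<k} (\<lambda>_. M)"
  interpret N: prob_space ?N by (intro prob_space_PiM prob_space_axioms)
  interpret K: prob_space ?K by (intro prob_space_PiM prob_space_axioms)
  let ?Pm = "{\<pi>. \<pi> permutes D}" let ?c = "1 / card {\<pi>. \<pi> permutes D}"
  have kD: "k \<le> card D"
    using D(3) q by (cases q) auto
  have fin: "finite ?Pm" using D(1) by (rule finite_permutations)
  have cp: "card ?Pm \<noteq> 0" using D(1) by (simp add: card_permutations)
  have cp1: "(\<Sum>\<pi>\<in>?Pm. ?c) = 1" using cp by simp
  \<comment> \<open>Cutting an injective sequence of length \<open>q * k\<close> into pieces gives disjoint blocks.\<close>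
  obtain e where e: "inj_on e {..<q*k}" "e ` {..<q*k} \<subseteq> D"
    using card_le_inj[of "{..<q*k}" D] D by auto
  have lt: "j * k + i < q * k" if "j < q" "i < k" for i j
  proof -
    have "j * k + i < Suc j * k" using that by simp
    also have "\<dots> \<le> q * k" using that by (intro mult_le_mono1) simp
    finally show ?thesis .
  qed
  have div: "(j * k + i) div k = j" if "i < k" for i j using that by simp
  define f where "f j = (\<lambda>i\<in>{..<k}. e (j * k + i))" for j
  have f: "f j \<in> injections k D" if "j < q" for j
  proof -
    have "inj_on (f j) {..<k}"
    proof (rule inj_onI)
      fix x y assume xy: "x \<in> {..<k}" "y \<in> {..<k}" "f j x = f j y"
      then have "e (j * k + x) = e (j * k + y)" by (simp add: f_def)
      from inj_onD[OF e(1) this] show "x = y" using lt[OF that] xy by simp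
    qed
    moreover have "f j i \<in> D" if "i < k" for i
      using e(2) lt[OF \<open>j < q\<close> that] that by (auto simp: f_def)
    moreover have "f j \<in> extensional {..<k}" by (simp add: f_def)
    ultimately show ?thesis unfolding injections_def by (auto simp: PiE_def)
  qed
  have disj: "j = j'" if "j < q" "j' < q" "i < k" "i' < k" "f j i = f j' i'" for i i' j j'
  proof -
    have "e (j * k + i) = e (j' * k + i')" using that by (simp add: f_def)
    from inj_onD[OF e(1) this] have "j * k + i = j' * k + i'" using that lt by simp
    then show ?thesis using div that by metis
  qed
  let ?g = "\<lambda>\<pi> j. \<lambda>i\<in>{..<k}. \<pi> (f j i)"
  let ?E = "\<lambda>\<pi> v. \<Prod>j<q. z powr h (subsample k v (?g \<pi> j))"
  have int: "integrable ?K (\<lambda>v. z powr h v)"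
  proof (rule K.integrable_const_bound[where B=z])
    show "AE v in ?K. norm (z powr h v) \<le> z"
      using z h01 by (auto intro!: powr_mono[of _ 1 z, simplified])
  qed simp
  have block: "(\<integral>v. ?E \<pi> v \<partial>?N) = (\<integral>v. z powr h v \<partial>?K) ^ q" "integrable ?N (?E \<pi>)"
    if "\<pi> permutes D" for \<pi>
  proof -
    have *: "?g \<pi> j i \<in> I" if "j < q" "i < k" for j i
      using permutes_in_image[OF \<open>\<pi> permutes D\<close>] f[OF that(1)] that D(2)
      by (auto dest: injections_range)
    have **: "inj_on (?g \<pi> j) {..<k}" if "j < q" for j
      using permutes_inj[OF \<open>\<pi> permutes D\<close>] f[OF that]
      by (auto simp: injections_def inj_on_def)
    have ***: "disjoint_family_on (\<lambda>j. ?g \<pi> j ` {..<k}) {..<q}"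
      using permutes_inj[OF \<open>\<pi> permutes D\<close>] disj
      by (auto simp: disjoint_family_on_def inj_eq)
    show "(\<integral>v. ?E \<pi> v \<partial>?N) = (\<integral>v. z powr h v \<partial>?K) ^ q" "integrable ?N (?E \<pi>)"
      using expectation_prod_blocks[OF k * ** *** int] by auto
  qed
  have jensen: "z powr (q * u_stat k D h v) \<le> (\<Sum>\<pi>\<in>?Pm. ?c * ?E \<pi> v)" for v
  proof -
    have eq: "q * u_stat k D h v = (\<Sum>\<pi>\<in>?Pm. ?c * (\<Sum>j<q. h (subsample k v (?g \<pi> j))))"
      by (rule u_stat_eq_permutation_average[OF D(1) kD f])
    have "ln z * (q * u_stat k D h v)
        = (\<Sum>\<pi>\<in>?Pm. ?c *\<^sub>R (ln z * (\<Sum>j<q. h (subsample k v (?g \<pi> j)))))"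
      unfolding eq real_scaleR_def sum_distrib_left[of "ln z" _ ?Pm] by (simp only: mult.left_commute)
    then have "z powr (q * u_stat k D h v)
        = exp (\<Sum>\<pi>\<in>?Pm. ?c *\<^sub>R (ln z * (\<Sum>j<q. h (subsample k v (?g \<pi> j)))))"
      using z by (simp add: powr_def mult.commute del: real_scaleR_def)
    also have "\<dots> \<le> (\<Sum>\<pi>\<in>?Pm. ?c * exp (ln z * (\<Sum>j<q. h (subsample k v (?g \<pi> j)))))"
      by (rule convex_on_sum[OF fin _ exp_convex cp1]) (auto intro: exI[of _ id])
    also have "\<dots> = (\<Sum>\<pi>\<in>?Pm. ?c * ?E \<pi> v)"
      using z by (simp add: powr_def exp_sum sum_distrib_left mult.commute)
    finally show ?thesis .
  qed
  have sumint: "integrable ?N (\<lambda>v. \<Sum>\<pi>\<in>?Pm. ?c * ?E \<pi> v)"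
    using block(2) by (intro Bochner_Integration.integrable_sum integrable_mult_right) auto
  have [measurable]: "u_stat k D h \<in> borel_measurable ?N"
    by (rule u_stat_measurable) (use D in auto)
  show intz: "integrable ?N (\<lambda>v. z powr (q * u_stat k D h v))"
  proof (rule Bochner_Integration.integrable_bound[OF sumint])
    show "AE v in ?N. norm (z powr (q * u_stat k D h v)) \<le> norm (\<Sum>\<pi>\<in>?Pm. ?c * ?E \<pi> v)"
      unfolding real_norm_def abs_of_nonneg[OF powr_ge_zero]
      by (intro AE_I2 order_trans[OF jensen abs_ge_self])
  qed simp
  have "(\<integral>v. z powr (q * u_stat k D h v) \<partial>?N) \<le> (\<integral>v. (\<Sum>\<pi>\<in>?Pm. ?c * ?E \<pi> v) \<partial>?N)"
    by (rule integral_mono[OF intz sumint jensen])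
  also have "\<dots> = (\<Sum>\<pi>\<in>?Pm. ?c * (\<integral>v. ?E \<pi> v \<partial>?N))"
    using block(2) by (subst Bochner_Integration.integral_sum) auto
  also have "\<dots> = (\<Sum>\<pi>\<in>?Pm. ?c) * (\<integral>v. z powr h v \<partial>?K) ^ q"
    unfolding sum_distrib_right by (intro sum.cong) (simp_all add: block(1))
  also have "\<dots> = (\<integral>v. z powr h v \<partial>?K) ^ q" unfolding cp1 by simp
  also have "\<dots> \<le> (1 + (\<integral>v. h v \<partial>?K) * (z - 1)) ^ q"
  proof (rule power_mono)
    have inth: "integrable ?K h" by (rule K.integrable_const_bound[where B=1]) (use h01 in auto)
    have "(\<integral>v. z powr h v \<partial>?K) \<le> (\<integral>v. 1 + h v * (z - 1) \<partial>?K)"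
      by (rule integral_mono[OF int]) (use inth powr_le_chord h01 z in auto)
    also have "\<dots> = 1 + (\<integral>v. h v \<partial>?K) * (z - 1)"
      using inth by (simp add: K.prob_space)
    finally show "(\<integral>v. z powr h v \<partial>?K) \<le> 1 + (\<integral>v. h v \<partial>?K) * (z - 1)" .
  qed simp
  finally show "(\<integral>v. z powr (q * u_stat k D h v) \<partial>?N) \<le> (1 + (\<integral>v. h v \<partial>?K) * (z - 1)) ^ q" .
qed

text \<open>
  Chernoff's bound with \<open>z\<close> in place of the exponential of the usual parameter.  Leaving \<open>z\<close> free
  makes both the regime of moderate and that of very small means available.
\<close>

lemma (in prob_space) u_stat_tail:
  fixes h :: "(nat \<Rightarrow> 'a) \<Rightarrow> real" and q :: nat
  assumes k: "0 < k" and D: "finite D" "D \<subseteq> I" "q * k \<le> card D" and q: "0 < q"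
    and h [measurable]: "h \<in> borel_measurable (PiM {..<k} (\<lambda>_. M))"
    and h01: "\<And>v. 0 \<le> h v" "\<And>v. h v \<le> 1" and z: "1 \<le> z"
  shows "\<P>(v in PiM I (\<lambda>_. M). u \<le> u_stat k D h v)
      \<le> ((1 + (\<integral>v. h v \<partial>PiM {..<k} (\<lambda>_. M)) * (z - 1)) / z powr u) ^ q"
proof -
  let ?N = "PiM I (\<lambda>_. M)"
  interpret N: prob_space ?N by (intro prob_space_PiM prob_space_axioms)
  note mgf = u_stat_mgf[OF k D q h h01 z]
  have [measurable]: "u_stat k D h \<in> borel_measurable ?N"
    by (rule u_stat_measurable) (use D in auto)
  have "\<P>(v in ?N. u \<le> u_stat k D h v) \<le> \<P>(v in ?N. z powr (q * u) \<le> z powr (q * u_stat k D h v))"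
    using z by (intro N.finite_measure_mono) (auto intro!: powr_mono mult_left_mono)
  also have "\<dots> \<le> (\<integral>v. z powr (q * u_stat k D h v) \<partial>?N) / z powr (q * u)"
    by (rule integral_Markov_inequality_measure[where A="{}"]) (use mgf z in auto)
  also have "\<dots> \<le> (1 + (\<integral>v. h v \<partial>PiM {..<k} (\<lambda>_. M)) * (z - 1)) ^ q / z powr (q * u)"
    by (intro divide_right_mono mgf) auto
  also have "z powr (q * u) = (z powr u) ^ q"
    using z by (simp add: powr_powr[symmetric] mult.commute powr_realpow)
  finally show ?thesis by (simp add: power_divide)
qed

section \<open>Independent draws for fixed data\<close>

lemma space_draw: "space (draw k D) = injections k D"
  unfolding draw_def injections_def by (rule space_uniform_count_measure)

lemma sets_draw [measurable_cong]: "sets (draw k D) = sets (count_space (injections k D))"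
  unfolding draw_def injections_def by (rule sets_uniform_count_measure_count_space)

lemma prob_space_draw: "finite D \<Longrightarrow> k \<le> card D \<Longrightarrow> prob_space (draw k D)"
  using injections_nonempty[of D k] finite_injections[of D k] unfolding draw_def
  by (intro prob_space_uniform_count_measure) (auto simp: injections_def)

lemma nn_integral_draw:
  assumes "finite D" "k \<le> card D" "\<And>f. f \<in> injections k D \<Longrightarrow> 0 \<le> \<psi> f"
  shows "(\<integral>\<^sup>+f. ennreal (\<psi> f) \<partial>draw k D)
    = ennreal ((\<Sum>f\<in>injections k D. \<psi> f) / card (injections k D))"
proof -
  have "(\<integral>\<^sup>+f. ennreal (\<psi> f) \<partial>draw k D)
      = (\<Sum>f\<in>injections k D. ennreal (1 / card (injections k D)) * ennreal (\<psi> f))"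
    using finite_injections[OF assms(1)] unfolding draw_def injections_def[symmetric] uniform_count_measure_def
    by (subst nn_integral_point_measure_finite) (auto simp: mult.commute)
  also have "\<dots> = (\<Sum>f\<in>injections k D. ennreal (\<psi> f / card (injections k D)))"
    using assms(3) by (intro sum.cong) (auto simp: ennreal_mult[symmetric])
  also have "\<dots> = ennreal ((\<Sum>f\<in>injections k D. \<psi> f) / card (injections k D))"
    using assms(3) by (subst sum_ennreal) (auto simp: sum_divide_distrib)
  finally show ?thesis .
qed

lemma (in prob_space) nn_integral_prod_iid:
  assumes "\<phi> \<in> borel_measurable M"
  shows "(\<integral>\<^sup>+x. (\<Prod>b<B. \<phi> (x b)) \<partial>PiM {..<B::nat} (\<lambda>_. M)) = (\<integral>\<^sup>+y. \<phi> y \<partial>M) ^ B"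
proof -
  interpret product_sigma_finite "\<lambda>_::nat. M"
    by standard
  show ?thesis using assms by (subst product_nn_integral_prod) auto
qed

text \<open>
  With the data fixed, the pairs of seed and draw are independent, so the probability is a power
  of the probability for one pair.  It factorises in two steps: first over the draws for given seeds,
  then over the seeds.
\<close>

lemma (in prob_space) prob_all_bad:
  assumes D: "finite D" "k \<le> card D"
    and F [measurable]: "\<And>f. f \<in> injections k D \<Longrightarrow> Measurable.pred M (F f)"
  shows "measure (PiM {..<B} (\<lambda>_. M) \<Otimes>\<^sub>M PiM {..<B} (\<lambda>_. draw k D))
      {x \<in> space (PiM {..<B} (\<lambda>_. M) \<Otimes>\<^sub>M PiM {..<B} (\<lambda>_. draw k D)).
        \<forall>b<B. F (snd x b) (fst x b)}
    = ((\<Sum>f\<in>injections k D. prob {\<omega>\<in>space M. F f \<omega>}) / card (injections k D)) ^ B"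
    (is "measure ?L ?E = ?a ^ B")
proof -
  let ?W = "PiM {..<B} (\<lambda>_. M)" and ?F = "PiM {..<B} (\<lambda>_. draw k D)"
  interpret d: prob_space "draw k D" by (rule prob_space_draw[OF D])
  interpret F: prob_space ?F by (intro prob_space_PiM d.prob_space_axioms)
  define \<phi> where "\<phi> f \<omega> = (of_bool (F f \<omega>) :: real)" for f \<omega>
  have [measurable]: "\<phi> f \<in> borel_measurable M" if "f \<in> injections k D" for f
    unfolding \<phi>_def using F[OF that] by measurable
  have fin: "finite (injections k D)" using D(1) by (rule finite_injections)
  define \<Psi> where "\<Psi> \<omega> = (\<Sum>f\<in>injections k D. \<phi> f \<omega>) / card (injections k D)" for \<omega>
  have [measurable]: "\<Psi> \<in> borel_measurable M" unfolding \<Psi>_def by measurable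
  have meas: "(\<lambda>x. ennreal (\<phi> (snd x b) (fst x b))) \<in> borel_measurable ?L" if "b < B" for b
  proof (rule measurable_compose_countable'[where g="\<lambda>x. snd x b" and I="injections k D"
        and f="\<lambda>f x. ennreal (\<phi> f (fst x b))"])
    show "(\<lambda>x. snd x b) \<in> ?L \<rightarrow>\<^sub>M count_space (injections k D)"
      unfolding measurable_cong_sets[OF refl sets_draw[symmetric]]
      by (rule measurable_compose[OF measurable_snd measurable_component_singleton]) (use that in auto)
    fix f assume f: "f \<in> injections k D"
    have [measurable]: "(\<lambda>x. fst x b) \<in> ?L \<rightarrow>\<^sub>M M"
      by (rule measurable_compose[OF measurable_fst measurable_component_singleton]) (use that in auto)
    show "(\<lambda>x. ennreal (\<phi> f (fst x b))) \<in> borel_measurable ?L"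
      using f by measurable
  qed (use fin in \<open>rule countable_finite\<close>)
  have meas2 [measurable]: "(\<lambda>x. \<Prod>b<B. ennreal (\<phi> (snd x b) (fst x b))) \<in> borel_measurable ?L"
    using meas by (intro borel_measurable_prod_ennreal) auto
  have prodind: "(\<Prod>b<B. ennreal (\<phi> (f b) (w b))) = (if \<forall>b<B. F (f b) (w b) then 1 else 0)" for f w
    by (auto simp: \<phi>_def)
  have E: "?E \<in> sets ?L"
  proof -
    have "?E = {x \<in> space ?L. (\<Prod>b<B. ennreal (\<phi> (snd x b) (fst x b))) = 1}"
      unfolding prodind by auto
    also have "\<dots> \<in> sets ?L" by measurable
    finally show ?thesis .
  qed
  have "emeasure ?L ?E = (\<integral>\<^sup>+x. (\<Prod>b<B. ennreal (\<phi> (snd x b) (fst x b))) \<partial>?L)"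
    unfolding nn_integral_indicator[OF E, symmetric] prodind
    by (intro nn_integral_cong) (auto simp: indicator_def)
  also have "\<dots> = (\<integral>\<^sup>+w. (\<integral>\<^sup>+f. (\<Prod>b<B. ennreal (\<phi> (f b) (w b))) \<partial>?F) \<partial>?W)"
    using F.nn_integral_fst[OF meas2] by simp
  also have "\<dots> = (\<integral>\<^sup>+w. (\<Prod>b<B. ennreal (\<Psi> (w b))) \<partial>?W)"
  proof (rule nn_integral_cong)
    fix w assume "w \<in> space ?W"
    interpret product_sigma_finite "\<lambda>_::nat. draw k D" by standard
    have "(\<integral>\<^sup>+f. (\<Prod>b<B. ennreal (\<phi> (f b) (w b))) \<partial>?F)
        = (\<Prod>b<B. \<integral>\<^sup>+f. ennreal (\<phi> f (w b)) \<partial>draw k D)"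
      by (rule product_nn_integral_prod) (auto simp: sets_draw cong: measurable_cong_sets)
    also have "\<dots> = (\<Prod>b<B. ennreal (\<Psi> (w b)))"
      unfolding \<Psi>_def by (intro prod.cong refl nn_integral_draw[OF D]) (simp add: \<phi>_def)
    finally show "(\<integral>\<^sup>+f. (\<Prod>b<B. ennreal (\<phi> (f b) (w b))) \<partial>?F) = (\<Prod>b<B. ennreal (\<Psi> (w b)))" .
  qed
  also have "\<dots> = (\<integral>\<^sup>+\<omega>. ennreal (\<Psi> \<omega>) \<partial>M) ^ B"
    by (rule nn_integral_prod_iid) simp
  also have "(\<integral>\<^sup>+\<omega>. ennreal (\<Psi> \<omega>) \<partial>M) = ennreal ?a"
  proof -
    have int: "integrable M (\<phi> f)" if "f \<in> injections k D" for f
      using that by (intro integrable_const_bound[where B=1]) (auto simp: \<phi>_def)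
    have "(\<integral>\<omega>. \<phi> f \<omega> \<partial>M) = prob {\<omega>\<in>space M. F f \<omega>}" if "f \<in> injections k D" for f
    proof -
      have "(\<integral>\<omega>. \<phi> f \<omega> \<partial>M) = (\<integral>\<omega>. indicator {\<omega>\<in>space M. F f \<omega>} \<omega> \<partial>M)"
        by (intro Bochner_Integration.integral_cong) (auto simp: \<phi>_def)
      also have "\<dots> = prob {\<omega>\<in>space M. F f \<omega>}"
        using F[OF that] by simp
      finally show ?thesis .
    qed
    then have "(\<integral>\<omega>. \<Psi> \<omega> \<partial>M) = ?a"
      unfolding \<Psi>_def using int by simp
    moreover have \<Psi>0: "0 \<le> \<Psi> \<omega>" for \<omega>
      unfolding \<Psi>_def by (simp add: \<phi>_def sum_nonneg)
    moreover have "integrable M \<Psi>" unfolding \<Psi>_def using int by simp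
    ultimately show ?thesis
      using \<Psi>0 by (subst nn_integral_eq_integral) simp_all
  qed
  also have "ennreal ?a ^ B = ennreal (?a ^ B)"
    by (simp add: ennreal_power sum_nonneg)
  finally show ?thesis by (simp add: measure_def sum_nonneg)
qed

text \<open>
  The form in which conditioning on the data is used: outside of an exceptional set \<open>G\<close> of data, the
  conditional probability is at most \<open>c\<close>.
\<close>

lemma prob_pair_le:
  assumes "prob_space N" "prob_space R"
    and E: "E \<in> sets (N \<Otimes>\<^sub>M R)" and G: "G \<in> sets N" and c: "0 \<le> c"
    and le: "\<And>v. v \<in> space N \<Longrightarrow> v \<notin> G \<Longrightarrow> measure R (Pair v -` E) \<le> c"
  shows "measure (N \<Otimes>\<^sub>M R) E \<le> measure N G + c"
proof -
  interpret N: prob_space N by fact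
  interpret R: prob_space R by fact
  interpret NR: pair_prob_space N R ..
  have "emeasure (N \<Otimes>\<^sub>M R) E = (\<integral>\<^sup>+v. emeasure R (Pair v -` E) \<partial>N)"
    by (rule R.emeasure_pair_measure_alt[OF E])
  also have "\<dots> \<le> (\<integral>\<^sup>+v. indicator G v + ennreal c \<partial>N)"
  proof (rule nn_integral_mono)
    fix v assume v: "v \<in> space N"
    show "emeasure R (Pair v -` E) \<le> indicator G v + ennreal c"
    proof (cases "v \<in> G")
      case True
      have "emeasure R (Pair v -` E) \<le> 1" by (rule R.measure_le_1)
      also have "\<dots> \<le> 1 + ennreal c" by simp
      finally show ?thesis using True by simp
    next
      case False
      then show ?thesis using le[OF v] by (simp add: R.emeasure_eq_measure ennreal_leI)
    qed
  qed
  also have "\<dots> = emeasure N G + ennreal c"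
    using G by (subst nn_integral_add) (auto simp: N.emeasure_space_1)
  finally show ?thesis
    using c by (simp add: NR.emeasure_eq_measure N.emeasure_eq_measure ennreal_plus[symmetric]
        del: ennreal_plus)
qed

section \<open>The two bad events under the law of data and draws\<close>

lemma measurable_random_subsample:
  assumes D: "finite D" "D \<subseteq> I" and X: "X \<in> L \<rightarrow>\<^sub>M PiM I (\<lambda>_. M)" and F: "F \<in> L \<rightarrow>\<^sub>M draw k D"
  shows "(\<lambda>x. subsample k (X x) (F x)) \<in> L \<rightarrow>\<^sub>M PiM {..<k} (\<lambda>_. M)"
proof (rule measurable_compose_countable'[where g=F and I="injections k D"
        and f="\<lambda>f x. subsample k (X x) f"])
  show "F \<in> L \<rightarrow>\<^sub>M count_space (injections k D)"
    using F unfolding measurable_cong_sets[OF refl sets_draw] .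
  fix f assume "f \<in> injections k D"
  then show "(\<lambda>x. subsample k (X x) f) \<in> L \<rightarrow>\<^sub>M PiM {..<k} (\<lambda>_. M)"
    using D injections_range by (intro measurable_compose[OF X measurable_subsample]) blast
qed (use finite_injections[OF D(1)] in \<open>rule countable_finite\<close>)

text \<open>
  The exceptional data are those with \<open>u_stat \<ge> u\<close> for the kernel \<open>h s\<close>, the probability
  over the seed that the learner fails on the sample \<open>s\<close>.
\<close>

lemma (in prob_space) prob_all_candidates_bad:
  fixes u :: real and q B :: nat
  assumes Q: "prob_space Q"
    and k: "0 < k" and D: "finite D" "D \<subseteq> I" "q * k \<le> card D" and q: "0 < q"
    and Bad: "Bad \<in> sets (PiM {..<k} (\<lambda>_. M) \<Otimes>\<^sub>M Q)" and z: "1 \<le> z" and u: "0 \<le> u"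
  defines "L \<equiv> PiM I (\<lambda>_. M) \<Otimes>\<^sub>M PiM {..<B} (\<lambda>_. Q) \<Otimes>\<^sub>M PiM {..<B} (\<lambda>_. draw k D)"
  defines "E \<equiv> {x \<in> space L. \<forall>b<B. (subsample k (fst x) (snd (snd x) b), fst (snd x) b) \<in> Bad}"
  defines "e \<equiv> measure (PiM {..<k} (\<lambda>_. M) \<Otimes>\<^sub>M Q) Bad"
  shows "E \<in> sets L" and "measure L E \<le> ((1 + e * (z - 1)) / z powr u) ^ q + u ^ B"
proof -
  let ?N = "PiM I (\<lambda>_. M)" and ?K = "PiM {..<k} (\<lambda>_. M)"
  let ?W = "PiM {..<B} (\<lambda>_. Q)" and ?F = "PiM {..<B} (\<lambda>_. draw k D)"
  interpret Q: prob_space Q by fact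
  interpret N: prob_space ?N by (intro prob_space_PiM prob_space_axioms)
  interpret K: prob_space ?K by (intro prob_space_PiM prob_space_axioms)
  interpret KQ: pair_prob_space ?K Q ..
  have kD: "k \<le> card D" using D(3) q by (cases q) auto
  interpret d: prob_space "draw k D" by (rule prob_space_draw[OF D(1) kD])
  interpret F: prob_space ?F by (intro prob_space_PiM d.prob_space_axioms)
  interpret W: prob_space ?W by (intro prob_space_PiM Q.prob_space_axioms)
  interpret WF: pair_prob_space ?W ?F ..
  define h where "h s = measure Q (Pair s -` Bad)" for s
  have hm [measurable]: "h \<in> borel_measurable ?K"
    unfolding h_def measure_def using Q.measurable_emeasure_Pair[OF Bad] by measurable
  have h01: "0 \<le> h s" "h s \<le> 1" for s unfolding h_def by auto
  have "ennreal e = (\<integral>\<^sup>+s. ennreal (h s) \<partial>?K)"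
    unfolding e_def h_def KQ.emeasure_eq_measure[symmetric] Q.emeasure_eq_measure[symmetric]
    by (rule Q.emeasure_pair_measure_alt[OF Bad])
  also have "\<dots> = ennreal (\<integral>s. h s \<partial>?K)"
    by (rule nn_integral_eq_integral) (use h01 in \<open>auto intro!: K.integrable_const_bound[where B=1]\<close>)
  finally have e: "e = (\<integral>s. h s \<partial>?K)"
    using h01 by (simp add: e_def)
  have [measurable]: "u_stat k D h \<in> borel_measurable ?N"
    by (rule u_stat_measurable) (use D in auto)
  have pair: "(\<lambda>x. (subsample k (fst x) (snd (snd x) b), fst (snd x) b)) \<in> L \<rightarrow>\<^sub>M ?K \<Otimes>\<^sub>M Q"
    if b: "b < B" for b
  proof (rule measurable_Pair)
    show "(\<lambda>x. fst (snd x) b) \<in> L \<rightarrow>\<^sub>M Q"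
      unfolding L_def using b
      by (intro measurable_compose[OF measurable_snd measurable_compose[OF measurable_fst
            measurable_component_singleton]]) auto
    show "(\<lambda>x. subsample k (fst x) (snd (snd x) b)) \<in> L \<rightarrow>\<^sub>M ?K"
    proof (rule measurable_random_subsample[OF D(1,2)])
      show "fst \<in> L \<rightarrow>\<^sub>M ?N" unfolding L_def by simp
      show "(\<lambda>x. snd (snd x) b) \<in> L \<rightarrow>\<^sub>M draw k D"
        unfolding L_def using b
        by (intro measurable_compose[OF measurable_snd measurable_compose[OF measurable_snd
            measurable_component_singleton]]) auto
    qed
  qed
  show E: "E \<in> sets L"
  proof -
    have "{x \<in> space L. \<forall>b\<in>{..<B}. (subsample k (fst x) (snd (snd x) b), fst (snd x) b) \<in> Bad} \<in> sets L"
    proof (rule sets.sets_Collect_finite_All)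
      fix b assume "b \<in> {..<B}"
      then show "{x \<in> space L. (subsample k (fst x) (snd (snd x) b), fst (snd x) b) \<in> Bad} \<in> sets L"
        using pred_sets2[OF Bad pair[of b]] unfolding pred_def lessThan_iff by blast
    qed simp
    then show ?thesis unfolding E_def Ball_def lessThan_iff .
  qed
  have "measure L E \<le> measure ?N {v \<in> space ?N. u \<le> u_stat k D h v} + u ^ B"
    unfolding L_def
  proof (rule prob_pair_le[OF N.prob_space_axioms WF.prob_space_axioms E[unfolded L_def]])
    fix v assume v: "v \<in> space ?N" and "v \<notin> {v \<in> space ?N. u \<le> u_stat k D h v}"
    then have le: "u_stat k D h v \<le> u" by auto
    have vim: "{\<omega> \<in> space Q. (s, \<omega>) \<in> Bad} = Pair s -` Bad" for s
      using sets.sets_into_space[OF Bad] by (auto simp: space_pair_measure)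
    have "Pair v -` E = {x \<in> space (?W \<Otimes>\<^sub>M ?F). \<forall>b<B. (subsample k v (snd x b), fst x b) \<in> Bad}"
      using v unfolding E_def L_def by (auto simp: space_pair_measure)
    then have "measure (?W \<Otimes>\<^sub>M ?F) (Pair v -` E)
        = ((\<Sum>f\<in>injections k D. Q.prob {\<omega>\<in>space Q. (subsample k v f, \<omega>) \<in> Bad}) / card (injections k D)) ^ B"
      using Q.prob_all_bad[OF D(1) kD, where F="\<lambda>f \<omega>. (subsample k v f, \<omega>) \<in> Bad" and B=B]
        sets_Pair1[OF Bad] vim by (simp add: pred_def)
    also have "\<dots> = u_stat k D h v ^ B"
      unfolding u_stat_def h_def vim ..
    also have "\<dots> \<le> u ^ B"
      using le by (intro power_mono) (auto simp: u_stat_def h_def sum_nonneg)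
    finally show "measure (?W \<Otimes>\<^sub>M ?F) (Pair v -` E) \<le> u ^ B" .
  qed (use u in auto)
  also have "\<dots> \<le> ((1 + e * (z - 1)) / z powr u) ^ q + u ^ B"
    unfolding e by (intro add_right_mono u_stat_tail[OF k D q _ h01 z]) simp
  finally show "measure L E \<le> ((1 + e * (z - 1)) / z powr u) ^ q + u ^ B" .
qed

text \<open>
  The exponential bound serves thresholds bounded away from 0, where a bad output needs half of the
  draws to deviate (\<open>c = 2\<close>).  Markov's inequality also covers the small shares \<open>1 / c\<close> that
  matter when votes are split between several optima.
\<close>

lemma (in prob_space) prob_many_deviating:
  fixes q c B :: nat and \<tau> z :: real
  assumes k: "0 < k" and D: "finite D" "D \<subseteq> I" "q * k \<le> card D" and q: "0 < q"
    and H: "H \<in> sets (PiM {..<k} (\<lambda>_. M))" 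
  defines "L \<equiv> PiM I (\<lambda>_. M) \<Otimes>\<^sub>M PiM {..<B} (\<lambda>_. draw k D)"
  defines "E \<equiv> \<lambda>c. {x \<in> space L. B \<le> c * card {b \<in> {..<B}. subsample k (fst x) (snd x b) \<in> H}}"
  defines "\<tau> \<equiv> measure (PiM {..<k} (\<lambda>_. M)) H"
  shows "E c \<in> sets L"
    and "1 \<le> z \<Longrightarrow> measure L (E 2) \<le> ((1 + \<tau> * (z - 1)) / z powr (1/3)) ^ q + (17/18) ^ B"
    and "0 < B \<Longrightarrow> measure L (E c) \<le> c * \<tau>"
proof -
  let ?N = "PiM I (\<lambda>_. M)" and ?K = "PiM {..<k} (\<lambda>_. M)"
  let ?G = "PiM {..<B} (\<lambda>_. draw k D)"
  interpret N: prob_space ?N by (intro prob_space_PiM prob_space_axioms)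
  interpret K: prob_space ?K by (intro prob_space_PiM prob_space_axioms)
  have kD: "k \<le> card D" using D(3) q by (cases q) auto
  interpret d: prob_space "draw k D" by (rule prob_space_draw[OF D(1) kD])
  interpret G: prob_space ?G by (intro prob_space_PiM d.prob_space_axioms)
  interpret L: pair_prob_space ?N ?G ..
  define h where "h s = (indicator H s :: real)" for s
  have hm [measurable]: "h \<in> borel_measurable ?K"
    unfolding h_def using H by measurable
  have h01: "0 \<le> h s" "h s \<le> 1" for s unfolding h_def by (auto simp: indicator_def)
  have \<tau>: "\<tau> = (\<integral>s. h s \<partial>?K)" unfolding \<tau>_def h_def using H by simp
  have [measurable]: "u_stat k D h \<in> borel_measurable ?N"
    by (rule u_stat_measurable) (use D in auto)
  have sub: "(\<lambda>x. subsample k (fst x) (snd x b)) \<in> L \<rightarrow>\<^sub>M ?K" if b: "b < B" for b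
  proof (rule measurable_random_subsample[OF D(1,2)])
    show "fst \<in> L \<rightarrow>\<^sub>M ?N" unfolding L_def by simp
    show "(\<lambda>x. snd x b) \<in> L \<rightarrow>\<^sub>M draw k D"
      unfolding L_def using b
      by (intro measurable_compose[OF measurable_snd measurable_component_singleton]) auto
  qed
  define W where "W x = (\<Sum>b<B. h (subsample k (fst x) (snd x b)))" for x
  have W: "real (card {b \<in> {..<B}. subsample k (fst x) (snd x b) \<in> H}) = W x" for x
    unfolding W_def h_def by (simp add: indicator_def sum.If_cases Int_def conj_commute)
  have Wm [measurable]: "W \<in> borel_measurable L"
    unfolding W_def using measurable_compose[OF sub hm] by (intro borel_measurable_sum) auto
  have E_W: "E c = {x \<in> space L. real B \<le> c * W x}" for c
    unfolding E_def W[symmetric] of_nat_mult[symmetric] of_nat_le_iff ..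
  show E: "E c \<in> sets L" for c unfolding E_W by measurable
  show "measure L (E 2) \<le> ((1 + \<tau> * (z - 1)) / z powr (1/3)) ^ q + (17/18) ^ B" if z: "1 \<le> z"
  proof -
    have "measure L (E 2) \<le> measure ?N {v \<in> space ?N. 1/3 \<le> u_stat k D h v} + (17/18) ^ B"
      unfolding L_def
    proof (rule prob_pair_le[OF N.prob_space_axioms G.prob_space_axioms E[unfolded L_def]])
      fix v assume v: "v \<in> space ?N" and "v \<notin> {v \<in> space ?N. 1/3 \<le> u_stat k D h v}"
      then have le: "u_stat k D h v \<le> 1/3" by auto
      \<comment> \<open>An exponential Markov inequality: the indicator of the event is at most
        \<open>(3/2) ^ (2 * #deviating - B)\<close>, a product over the draws with factor \<open>3/2\<close> for a
        deviating draw and \<open>2/3\<close> otherwise.  The mean of a factor is \<open>2/3 + 5/6 * U\<close>, which is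
        at most \<open>17/18\<close> as long as \<open>U \<le> 1/3\<close>.\<close>
      define \<psi> where "\<psi> f = 2/3 + 5/6 * h (subsample k v f)" for f
      have \<psi>0: "0 \<le> \<psi> f" for f unfolding \<psi>_def using h01(1)[of "subsample k v f"] by simp
      have "card (injections k D) \<noteq> 0"
        using finite_injections[OF D(1)] injections_nonempty[OF D(1) kD] by simp
      then have avg: "(\<Sum>f\<in>injections k D. \<psi> f) / card (injections k D) = 2/3 + 5/6 * u_stat k D h v"
        unfolding \<psi>_def u_stat_def sum.distrib sum_distrib_left[symmetric] by (simp add: field_simps)
      have sec: "Pair v -` E 2 \<in> sets ?G" using sets_Pair1[OF E[unfolded L_def]] .
      have "indicator (Pair v -` E 2) g \<le> (\<Prod>b<B. ennreal (\<psi> (g b)))" for g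
      proof (cases "(v, g) \<in> E 2")
        case True
        let ?S = "{b \<in> {..<B}. subsample k v (g b) \<in> H}"
        have fin: "finite ?S" by simp
        have "(\<Prod>b<B. \<psi> (g b)) = (\<Prod>b<B. 2/3 * (if b \<in> ?S then 9/4 else 1))"
          by (intro prod.cong) (auto simp: \<psi>_def h_def)
        also have "\<dots> = (2/3) ^ B * (9/4) ^ card ?S"
          unfolding prod.distrib by (simp add: prod.If_cases Int_def)
        also have "\<dots> = (2/3) ^ B * (3/2) ^ (2 * card ?S)"
          by (simp add: power_mult power2_eq_square)
        also have "\<dots> \<ge> (2/3) ^ B * (3/2) ^ B"
          using True unfolding E_def by (intro mult_left_mono power_increasing) auto
        finally have "1 \<le> (\<Prod>b<B. \<psi> (g b))"
          by (simp add: power_mult_distrib[symmetric])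
        then show ?thesis using \<psi>0 True by (simp add: prod_ennreal)
      qed simp
      then have "emeasure ?G (Pair v -` E 2) \<le> (\<integral>\<^sup>+g. (\<Prod>b<B. ennreal (\<psi> (g b))) \<partial>?G)"
        unfolding nn_integral_indicator[OF sec, symmetric] by (intro nn_integral_mono) auto
      also have "\<dots> = (\<integral>\<^sup>+f. ennreal (\<psi> f) \<partial>draw k D) ^ B"
        by (rule d.nn_integral_prod_iid) (simp add: sets_draw cong: measurable_cong_sets)
      also have "\<dots> = ennreal (2/3 + 5/6 * u_stat k D h v) ^ B"
        using nn_integral_draw[OF D(1) kD, of \<psi>] \<psi>0 avg by simp
      also have "\<dots> \<le> ennreal (17/18) ^ B"
        using le by (intro power_mono ennreal_leI) auto
      finally show "measure ?G (Pair v -` E 2) \<le> (17/18) ^ B"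
        by (simp add: G.emeasure_eq_measure ennreal_power)
    qed auto
    also have "\<dots> \<le> ((1 + \<tau> * (z - 1)) / z powr (1/3)) ^ q + (17/18) ^ B"
      unfolding \<tau> by (intro add_right_mono u_stat_tail[OF k D q _ h01 z]) simp
    finally show ?thesis .
  qed
  show "measure L (E c) \<le> c * \<tau>" if B: "0 < B"
  proof -
    have exp_h: "(\<integral>x. h (subsample k (fst x) (snd x b)) \<partial>L) = \<tau>"
      and int_h: "integrable L (\<lambda>x. h (subsample k (fst x) (snd x b)))" if b: "b < B" for b
    proof -
      let ?X = "{x \<in> space L. subsample k (fst x) (snd x b) \<in> H}"
      have X: "?X \<in> sets L"
        using sub[OF b] H by measurable
      have "emeasure L ?X = (\<integral>\<^sup>+g. emeasure ?N ((\<lambda>v. (v, g)) -` ?X) \<partial>?G)"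
        unfolding L_def by (rule L.emeasure_pair_measure_alt2[OF X[unfolded L_def]])
      also have "\<dots> = (\<integral>\<^sup>+g. ennreal \<tau> \<partial>?G)"
      proof (rule nn_integral_cong)
        fix g assume g: "g \<in> space ?G"
        then have gb: "g b \<in> injections k D" using b by (auto simp: space_PiM space_draw)
        then have gI: "inj_on (g b) {..<k}" "\<And>i. i < k \<Longrightarrow> g b i \<in> I"
          using D(2) injections_range[OF gb] by (auto simp: injections_def)
        have "(\<lambda>v. (v, g)) -` ?X = (\<lambda>v. subsample k v (g b)) -` H \<inter> space ?N"
          using g by (auto simp: L_def space_pair_measure)
        then have "emeasure ?N ((\<lambda>v. (v, g)) -` ?X)
            = emeasure (distr ?N ?K (\<lambda>v. subsample k v (g b))) H"
          by (simp add: emeasure_distr[OF measurable_subsample H] gI)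
        also have "\<dots> = ennreal \<tau>"
          using distr_subsample[OF gI] by (simp add: \<tau>_def K.emeasure_eq_measure)
        finally show "emeasure ?N ((\<lambda>v. (v, g)) -` ?X) = ennreal \<tau>" .
      qed
      finally have "measure L ?X = \<tau>"
        by (simp add: G.emeasure_space_1 measure_def \<tau>_def)
      moreover have "(\<integral>x. h (subsample k (fst x) (snd x b)) \<partial>L) = (\<integral>x. indicator ?X x \<partial>L)"
        by (intro Bochner_Integration.integral_cong) (auto simp: h_def indicator_def)
      ultimately show "(\<integral>x. h (subsample k (fst x) (snd x b)) \<partial>L) = \<tau>"
        using X by simp
      show "integrable L (\<lambda>x. h (subsample k (fst x) (snd x b)))"
        unfolding L_def
        by (rule L.integrable_const_bound[where B=1])
          (use h01 measurable_compose[OF sub[OF b] hm] in \<open>auto simp: L_def\<close>)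
    qed
    have "measure L (E c) \<le> (\<integral>x. c * W x \<partial>L) / B"
      unfolding E_W
    proof (rule integral_Markov_inequality_measure[where A="{}"])
      show "integrable L (\<lambda>x. c * W x)"
        unfolding W_def using int_h by (intro integrable_mult_right Bochner_Integration.integrable_sum) auto
    qed (use h01 B in \<open>auto simp: W_def sum_nonneg\<close>)
    also have "(\<integral>x. c * W x \<partial>L) = c * (B * \<tau>)"
      unfolding W_def using int_h exp_h by (simp add: Bochner_Integration.integral_sum)
    finally show ?thesis using B by simp
  qed
qed

section \<open>Counting votes\<close>

lemma emp_risk_close:
  assumes "\<not> ereal t < sup_dev P l \<Theta> k v" "\<theta> \<in> \<Theta>"
  shows "\<bar>emp_risk l k v \<theta> - risk P l \<theta>\<bar> \<le> t"
proof -
  have "ereal \<bar>emp_risk l k v \<theta> - risk P l \<theta>\<bar> \<le> sup_dev P l \<Theta> k v"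
    unfolding sup_dev_def using assms(2) by (rule SUP_upper)
  also have "\<dots> \<le> ereal t" using assms(1) by simp
  finally show ?thesis by simp
qed

lemma votes_eq_card:
  "votes l k B v g S e \<theta> = card {b \<in> {..<B}. \<theta> \<in> near_optimal l k (subsample k v (g b)) S e}"
  unfolding votes_def by (simp add: sum.If_cases of_bool_def Int_def conj_commute)

text \<open>
  On a subsample that does not deviate, the empirical risks of \<open>\<theta>\<close> and \<open>\<theta>'\<close> differ by at least
  their true difference minus \<open>2 t\<close>, hence by more than the threshold.
\<close>

lemma votes_le_deviating:
  assumes S: "finite S" "S \<subseteq> \<Theta>" "\<theta> \<in> S" "\<theta>' \<in> S"
    and far: "risk P l \<theta>' + 2 * t + e < risk P l \<theta>"
  shows "votes l k B v g S e \<theta> \<le> card {b \<in> {..<B}. ereal t < sup_dev P l \<Theta> k (subsample k v (g b))}"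
  unfolding votes_eq_card
proof (intro card_mono subsetI)
  fix b assume b: "b \<in> {b \<in> {..<B}. \<theta> \<in> near_optimal l k (subsample k v (g b)) S e}"
  let ?v = "subsample k v (g b)"
  have "emp_risk l k ?v \<theta> \<le> Min (emp_risk l k ?v ` S) + e" using b by (simp add: near_optimal_def)
  also have "\<dots> \<le> emp_risk l k ?v \<theta>' + e" using S by (intro add_right_mono Min_le) auto
  finally have "emp_risk l k ?v \<theta> \<le> emp_risk l k ?v \<theta>' + e" .
  then have "\<not> (\<bar>emp_risk l k ?v \<theta> - risk P l \<theta>\<bar> \<le> t \<and> \<bar>emp_risk l k ?v \<theta>' - risk P l \<theta>'\<bar> \<le> t)"
    using far by linarith
  then have "ereal t < sup_dev P l \<Theta> k ?v"
    using emp_risk_close[of t P l \<Theta> k ?v] S(2-4) by blast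
  then show "b \<in> {b \<in> {..<B}. ereal t < sup_dev P l \<Theta> k (subsample k v (g b))}" using b by simp
qed simp

lemma votes_best_ge:
  assumes S: "finite S" "S \<subseteq> \<Theta>" "\<theta> \<in> S"
    and best: "\<And>\<theta>'. \<theta>' \<in> S \<Longrightarrow> risk P l \<theta> \<le> risk P l \<theta>'" and t: "2 * t \<le> e"
  shows "B \<le> votes l k B v g S e \<theta>
    + card {b \<in> {..<B}. ereal t < sup_dev P l \<Theta> k (subsample k v (g b))}"
proof -
  have "b \<in> {b \<in> {..<B}. \<theta> \<in> near_optimal l k (subsample k v (g b)) S e}
      \<union> {b \<in> {..<B}. ereal t < sup_dev P l \<Theta> k (subsample k v (g b))}" if b: "b < B" for b
  proof (cases "ereal t < sup_dev P l \<Theta> k (subsample k v (g b))")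
    case False
    let ?v = "subsample k v (g b)"
    have "emp_risk l k ?v \<theta> - e \<le> emp_risk l k ?v \<theta>'" if \<theta>': "\<theta>' \<in> S" for \<theta>'
    proof -
      have "\<bar>emp_risk l k ?v \<theta> - risk P l \<theta>\<bar> \<le> t" "\<bar>emp_risk l k ?v \<theta>' - risk P l \<theta>'\<bar> \<le> t"
        using emp_risk_close[OF False] S \<theta>' by blast+
      then show ?thesis using best[OF \<theta>'] t by linarith
    qed
    then have "emp_risk l k ?v \<theta> - e \<le> Min (emp_risk l k ?v ` S)"
      using S by (subst Min_ge_iff) auto
    then show ?thesis using b S(3) by (auto simp: near_optimal_def)
  qed (use b in auto)
  then have "{..<B} \<subseteq> {b \<in> {..<B}. \<theta> \<in> near_optimal l k (subsample k v (g b)) S e}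
      \<union> {b \<in> {..<B}. ereal t < sup_dev P l \<Theta> k (subsample k v (g b))}" by blast
  from card_mono[OF _ this] show ?thesis
    unfolding votes_eq_card using card_Un_le order_trans by fastforce
qed

lemma sum_votes_ge:
  assumes S: "finite S" "S \<noteq> {}" and e: "0 \<le> e"
  shows "B \<le> (\<Sum>\<theta>\<in>S. votes l k B v g S e \<theta>)"
proof -
  have "1 \<le> (\<Sum>\<theta>\<in>S. of_bool (\<theta> \<in> near_optimal l k (subsample k v (g b)) S e) :: nat)" for b
  proof -
    let ?r = "emp_risk l k (subsample k v (g b))"
    have "Min (?r ` S) \<in> ?r ` S" using S by (intro Min_in) auto
    then obtain \<theta> where \<theta>: "\<theta> \<in> S" "?r \<theta> = Min (?r ` S)" by auto
    then have "1 = (of_bool (\<theta> \<in> near_optimal l k (subsample k v (g b)) S e) :: nat)"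
      using e by (simp add: near_optimal_def)
    also have "\<dots> \<le> (\<Sum>\<theta>\<in>S. of_bool (\<theta> \<in> near_optimal l k (subsample k v (g b)) S e))"
      by (rule member_le_sum) (use S \<theta> in auto)
    finally show ?thesis .
  qed
  then have "(\<Sum>b<B. 1) \<le> (\<Sum>b<B. \<Sum>\<theta>\<in>S. of_bool (\<theta> \<in> near_optimal l k (subsample k v (g b)) S e) :: nat)"
    by (intro sum_mono)
  also have "\<dots> = (\<Sum>\<theta>\<in>S. votes l k B v g S e \<theta>)"
    unfolding votes_def by (rule sum.swap)
  finally show ?thesis by simp
qed

text \<open>
  The two conclusions compare the few votes of a far candidate with two lower bounds for the votes of
  the winner.  If the threshold is at least \<open>2 t\<close>, the best candidate collects the votes of all
  subsamples that do not deviate.  For smaller thresholds these votes may be spread over several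
  candidates, but the winner has at least the average number of votes.
\<close>

lemma far_winner_imp_deviating:
  fixes t e \<delta> :: real
  assumes S: "finite S" "S \<subseteq> \<Theta>"
    and win: "is_arg_max (votes l k B v g S e) (\<lambda>\<theta>. \<theta> \<in> S) \<theta>"
    and \<theta>0: "\<theta>0 \<in> S" and far: "risk P l \<theta>0 + \<delta> < risk P l \<theta>" and te: "2 * t + e \<le> \<delta>"
  defines "W \<equiv> card {b \<in> {..<B}. ereal t < sup_dev P l \<Theta> k (subsample k v (g b))}"
  shows "2 * t \<le> e \<Longrightarrow> B \<le> 2 * W" and "0 \<le> e \<Longrightarrow> B \<le> card S * W"
proof -
  have \<theta>: "\<theta> \<in> S" and max: "votes l k B v g S e \<theta>' \<le> votes l k B v g S e \<theta>" if "\<theta>' \<in> S" for \<theta>'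
    using win that \<theta>0 by (auto simp: is_arg_max_linorder)
  have le_W: "votes l k B v g S e \<theta> \<le> W"
    unfolding W_def by (rule votes_le_deviating[OF S \<theta>[OF \<theta>0] \<theta>0]) (use far te in simp)
  show "B \<le> 2 * W" if t: "2 * t \<le> e"
  proof -
    obtain \<theta>' where \<theta>': "\<theta>' \<in> S" "\<And>\<eta>. \<eta> \<in> S \<Longrightarrow> risk P l \<theta>' \<le> risk P l \<eta>"
      using ex_min_if_finite[of "risk P l ` S"] S(1) \<theta>0
      by (metis (no_types, lifting) arg_min_if_finite(1) arg_min_least empty_iff)
    have "B \<le> votes l k B v g S e \<theta>' + W"
      unfolding W_def by (rule votes_best_ge[OF S \<theta>' t])
    with max[OF \<theta>'(1)] le_W show ?thesis by simp
  qed
  show "B \<le> card S * W" if e: "0 \<le> e"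
  proof -
    have "B \<le> (\<Sum>\<theta>\<in>S. votes l k B v g S e \<theta>)" by (rule sum_votes_ge) (use S \<theta>0 e in auto)
    also have "\<dots> \<le> (\<Sum>\<theta>\<in>S. W)" by (intro sum_mono order_trans[OF max le_W])
    finally show ?thesis by simp
  qed
qed

section \<open>A run of the algorithm\<close>

lemma distr_pair_outer:
  assumes "prob_space A" "prob_space B" "prob_space C" "prob_space D"
  shows "distr (A \<Otimes>\<^sub>M B \<Otimes>\<^sub>M C \<Otimes>\<^sub>M D) (A \<Otimes>\<^sub>M D) (\<lambda>x. (fst x, snd (snd (snd x)))) = A \<Otimes>\<^sub>M D"
proof (rule pair_measure_eqI[symmetric])
  interpret A: prob_space A by fact
  interpret B: prob_space B by fact
  interpret C: prob_space C by fact
  interpret D: prob_space D by fact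
  interpret CD: pair_prob_space C D ..
  interpret BCD: pair_prob_space B "C \<Otimes>\<^sub>M D" ..
  show "sigma_finite_measure A" "sigma_finite_measure D" by unfold_locales
  fix X Y assume X: "X \<in> sets A" and Y: "Y \<in> sets D"
  have "(\<lambda>x. (fst x, snd (snd (snd x)))) -` (X \<times> Y) \<inter> space (A \<Otimes>\<^sub>M B \<Otimes>\<^sub>M C \<Otimes>\<^sub>M D)
      = X \<times> space B \<times> space C \<times> Y"
    using sets.sets_into_space[OF X] sets.sets_into_space[OF Y] by (auto simp: space_pair_measure)
  then show "emeasure A X * emeasure D Y
      = emeasure (distr (A \<Otimes>\<^sub>M B \<Otimes>\<^sub>M C \<Otimes>\<^sub>M D) (A \<Otimes>\<^sub>M D) (\<lambda>x. (fst x, snd (snd (snd x))))) (X \<times> Y)"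
    using X Y by (simp add: emeasure_distr BCD.emeasure_pair_measure_Times CD.emeasure_pair_measure_Times
        D.emeasure_pair_measure_Times B.emeasure_space_1 C.emeasure_space_1)
qed simp

lemma distr_pair_map_snd:
  assumes "prob_space N" "prob_space R'" and f: "f \<in> R \<rightarrow>\<^sub>M R'" and d: "distr R R' f = R'"
  shows "distr (N \<Otimes>\<^sub>M R) (N \<Otimes>\<^sub>M R') (\<lambda>x. (fst x, f (snd x))) = N \<Otimes>\<^sub>M R'"
proof -
  interpret R': prob_space R' by fact
  have "distr N N (\<lambda>x. x) \<Otimes>\<^sub>M distr R R' f = distr (N \<Otimes>\<^sub>M R) (N \<Otimes>\<^sub>M R') (\<lambda>(x, y). (x, f y))"
    using f by (rule pair_measure_distr[OF measurable_ident_sets[OF refl]])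
      (unfold d, rule R'.sigma_finite_measure_axioms)
  then show ?thesis unfolding d distr_id case_prod_beta by (rule sym)
qed

lemma distr_pair_drop_last:
  assumes "prob_space A" "prob_space B" "prob_space C" "prob_space D"
  shows "distr (A \<Otimes>\<^sub>M B \<Otimes>\<^sub>M C \<Otimes>\<^sub>M D) (A \<Otimes>\<^sub>M B \<Otimes>\<^sub>M C) (\<lambda>x. (fst x, fst (snd x), fst (snd (snd x))))
    = A \<Otimes>\<^sub>M B \<Otimes>\<^sub>M C"
proof -
  have BC: "prob_space (B \<Otimes>\<^sub>M C)" using assms(2,3) by (rule prob_space_pair)
  have "distr (B \<Otimes>\<^sub>M C \<Otimes>\<^sub>M D) (B \<Otimes>\<^sub>M C) (\<lambda>x. (fst x, fst (snd x))) = B \<Otimes>\<^sub>M C"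
    by (rule distr_pair_map_snd[OF assms(2,3) measurable_fst prob_space.distr_pair_fst[OF assms(4)]])
  from distr_pair_map_snd[OF assms(1) BC _ this] show ?thesis by simp
qed

text \<open>
  The events of a run are expressed below by membership in two sets, of samples with a seed and of
  samples, because these sets carry the measurability and their probabilities are the two tails.
\<close>

definition failing_sample where
  "failing_sample P Q Th l A k \<delta> = {y \<in> space (PiM {..<k} (\<lambda>_. P) \<Otimes>\<^sub>M Q).
    min_risk P l (space Th) + \<delta> < risk P l (A k (fst y) (snd y))}"

definition deviating_sample where
  "deviating_sample P Th l k t = {v \<in> space (PiM {..<k} (\<lambda>_. P)). ereal t < sup_dev P l (space Th) k v}"

lemma measure_failing_sample:
  "measure (PiM {..<k} (\<lambda>_. P) \<Otimes>\<^sub>M Q) (failing_sample P Q Th l A k \<delta>) = excess_tail P l (space Th) Q A k \<delta>"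
  unfolding failing_sample_def excess_tail_def ..

lemma measure_deviating_sample:
  "measure (PiM {..<k} (\<lambda>_. P)) (deviating_sample P Th l k t) = dev_tail P l (space Th) k t"
  unfolding deviating_sample_def dev_tail_def ..

lemma (in learning_setting) measurable_risk [measurable]: "risk P l \<in> borel_measurable Th"
proof -
  have "(\<lambda>\<theta>. \<integral>z. l \<theta> z \<partial>P) \<in> borel_measurable Th"
    by (rule P.borel_measurable_lebesgue_integral[OF loss_measurable])
  then show ?thesis unfolding risk_def[abs_def] .
qed

lemma (in learning_setting) sets_failing_sample:
  assumes "0 < k"
  shows "failing_sample P Q Th l A k \<delta> \<in> sets (PiM {..<k} (\<lambda>_. P) \<Otimes>\<^sub>M Q)"
proof -
  have "(\<lambda>y. risk P l (A k (fst y) (snd y))) \<in> borel_measurable (PiM {..<k} (\<lambda>_. P) \<Otimes>\<^sub>M Q)"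
    using measurable_compose[OF learner_measurable[OF assms] measurable_risk]
    by (simp add: case_prod_beta)
  then show ?thesis unfolding failing_sample_def by measurable
qed

lemma sets_deviating_sample:
  assumes "sup_dev P l (space Th) k \<in> borel_measurable (PiM {..<k} (\<lambda>_. P))"
  shows "deviating_sample P Th l k t \<in> sets (PiM {..<k} (\<lambda>_. P))"
  unfolding deviating_sample_def using assms by measurable

lemma (in learning_setting) measurable_sup_dev_finite:
  assumes "finite (space Th)"
  shows "sup_dev P l (space Th) k \<in> borel_measurable (PiM {..<k} (\<lambda>_. P))"
proof -
  have [measurable]: "l \<theta> \<in> borel_measurable P" if "\<theta> \<in> space Th" for \<theta>
    using loss_integrable[OF that] by (rule borel_measurable_integrable)
  have "(\<lambda>v. ereal \<bar>emp_risk l k v \<theta> - risk P l \<theta>\<bar>) \<in> borel_measurable (PiM {..<k} (\<lambda>_. P))"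
    if "\<theta> \<in> space Th" for \<theta>
    unfolding emp_risk_def using that by measurable
  then show ?thesis
    unfolding sup_dev_def[abs_def] using assms by (intro borel_measurable_SUP countable_finite) auto
qed

context rove_run
begin

abbreviation "D1 \<equiv> phase1_idx sp n"
abbreviation "D2 \<equiv> phase2_idx sp n"

lemma index_sets: "finite D1" "finite D2" "D1 \<subseteq> {..<n}" "D2 \<subseteq> {..<n}" "k1 \<le> card D1" "k2 \<le> card D2"
  "0 < k1" "0 < k2"
  using sizes unfolding phase1_idx_def phase2_idx_def subsample_size_ok_def by (auto split: if_splits)

lemma prob_space_components:
  "prob_space (PiM {..<n} (\<lambda>_. P))" "prob_space (PiM {..<B1} (\<lambda>_. Q))"
  "prob_space (PiM {..<B1} (\<lambda>_. draw k1 D1))" "prob_space (PiM {..<B2} (\<lambda>_. draw k2 D2))"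
  using P.prob_space_axioms Q.prob_space_axioms index_sets
  by (auto intro!: prob_space_PiM prob_space_draw)

lemma measurable_phase1 [measurable]:
    "(\<lambda>x. (data x, seed x, draw1 x)) \<in> M \<rightarrow>\<^sub>M
      PiM {..<n} (\<lambda>_. P) \<Otimes>\<^sub>M PiM {..<B1} (\<lambda>_. Q) \<Otimes>\<^sub>M PiM {..<B1} (\<lambda>_. draw k1 D1)" (is "?X \<in> M \<rightarrow>\<^sub>M ?L")
  and law_phase1:
    "distr M (PiM {..<n} (\<lambda>_. P) \<Otimes>\<^sub>M PiM {..<B1} (\<lambda>_. Q) \<Otimes>\<^sub>M PiM {..<B1} (\<lambda>_. draw k1 D1))
        (\<lambda>x. (data x, seed x, draw1 x))
      = PiM {..<n} (\<lambda>_. P) \<Otimes>\<^sub>M PiM {..<B1} (\<lambda>_. Q) \<Otimes>\<^sub>M PiM {..<B1} (\<lambda>_. draw k1 D1)"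
  and measurable_phase2 [measurable]:
    "(\<lambda>x. (data x, draw2 x)) \<in> M \<rightarrow>\<^sub>M PiM {..<n} (\<lambda>_. P) \<Otimes>\<^sub>M PiM {..<B2} (\<lambda>_. draw k2 D2)"
  and law_phase2:
    "distr M (PiM {..<n} (\<lambda>_. P) \<Otimes>\<^sub>M PiM {..<B2} (\<lambda>_. draw k2 D2)) (\<lambda>x. (data x, draw2 x))
      = PiM {..<n} (\<lambda>_. P) \<Otimes>\<^sub>M PiM {..<B2} (\<lambda>_. draw k2 D2)"
proof -
  note law = randomness_law[unfolded run_law_def]
  note meas = randomness_measurable[unfolded run_law_def]
  let ?L2 = "PiM {..<n} (\<lambda>_. P) \<Otimes>\<^sub>M PiM {..<B2} (\<lambda>_. draw k2 D2)"
  show "?X \<in> M \<rightarrow>\<^sub>M ?L"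
    using measurable_compose[OF meas, of "\<lambda>x. (fst x, fst (snd x), fst (snd (snd x)))" ?L] by simp
  show "(\<lambda>x. (data x, draw2 x)) \<in> M \<rightarrow>\<^sub>M ?L2"
    using measurable_compose[OF meas, of "\<lambda>x. (fst x, snd (snd (snd x)))" ?L2] by simp
  show "distr M ?L ?X = ?L"
    using distr_pair_drop_last[OF prob_space_components]
    by (subst (asm) law[symmetric], subst (asm) distr_distr[OF _ meas]) (auto simp: comp_def)
  show "distr M ?L2 (\<lambda>x. (data x, draw2 x)) = ?L2"
    using distr_pair_outer[OF prob_space_components]
    by (subst (asm) law[symmetric], subst (asm) distr_distr[OF _ meas]) (auto simp: comp_def)
qed

definition no_good_candidate where
  "no_good_candidate \<delta> = {x \<in> space M. \<forall>b<B1.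
    (subsample k1 (data x) (draw1 x b), seed x b) \<in> failing_sample P Q Th l A k1 \<delta>}"

definition many_deviating where
  "many_deviating c t = {x \<in> space M.
    B2 \<le> c * card {b \<in> {..<B2}. subsample k2 (data x) (draw2 x b) \<in> deviating_sample P Th l k2 t}}"

lemma prob_no_good_candidate:
  fixes q :: nat and \<delta> z u :: real
  assumes q: "0 < q" "q * k1 \<le> card D1" and z: "1 \<le> z" and u: "0 \<le> u"
  defines "E \<equiv> excess_tail P l (space Th) Q A k1 \<delta>"
  shows "no_good_candidate \<delta> \<in> M.events"
    and "M.prob (no_good_candidate \<delta>) \<le> ((1 + E * (z - 1)) / z powr u) ^ q + u ^ B1"
proof -
  let ?L = "PiM {..<n} (\<lambda>_. P) \<Otimes>\<^sub>M PiM {..<B1} (\<lambda>_. Q) \<Otimes>\<^sub>M PiM {..<B1} (\<lambda>_. draw k1 D1)"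
  let ?E = "{x \<in> space ?L. \<forall>b<B1.
    (subsample k1 (fst x) (snd (snd x) b), fst (snd x) b) \<in> failing_sample P Q Th l A k1 \<delta>}"
  note b = P.prob_all_candidates_bad[OF Q.prob_space_axioms index_sets(7,1,3) q(2,1)
      sets_failing_sample[OF index_sets(7)] z u]
  have eq: "no_good_candidate \<delta> = (\<lambda>x. (data x, seed x, draw1 x)) -` ?E \<inter> space M"
    using measurable_space[OF measurable_phase1] unfolding no_good_candidate_def by auto
  show "no_good_candidate \<delta> \<in> M.events"
    unfolding eq by (rule measurable_sets[OF measurable_phase1 b(1)])
  have "M.prob (no_good_candidate \<delta>) = measure ?L ?E"
    unfolding eq measure_distr[OF measurable_phase1 b(1), symmetric] law_phase1 ..
  with b(2)[where B=B1] show "M.prob (no_good_candidate \<delta>) \<le> ((1 + E * (z - 1)) / z powr u) ^ q + u ^ B1"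
    unfolding E_def measure_failing_sample by simp
qed

lemma prob_many_deviating:
  fixes q c :: nat and t z \<tau> :: real
  assumes q: "0 < q" "q * k2 \<le> card D2"
    and dev: "sup_dev P l (space Th) k2 \<in> borel_measurable (PiM {..<k2} (\<lambda>_. P))"
  defines "\<tau> \<equiv> dev_tail P l (space Th) k2 t"
  shows "many_deviating c t \<in> M.events"
    and "1 \<le> z \<Longrightarrow> M.prob (many_deviating 2 t) \<le> ((1 + \<tau> * (z - 1)) / z powr (1/3)) ^ q + (17/18) ^ B2"
    and "M.prob (many_deviating c t) \<le> c * \<tau>"
proof -
  let ?L = "PiM {..<n} (\<lambda>_. P) \<Otimes>\<^sub>M PiM {..<B2} (\<lambda>_. draw k2 D2)"
  let ?E = "\<lambda>c. {x \<in> space ?L.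
    B2 \<le> c * card {b \<in> {..<B2}. subsample k2 (fst x) (snd x b) \<in> deviating_sample P Th l k2 t}}"
  note b = P.prob_many_deviating[OF index_sets(8,2,4) q(2,1) sets_deviating_sample[OF dev],
      where B=B2, unfolded measure_deviating_sample]
  have eq: "many_deviating c t = (\<lambda>x. (data x, draw2 x)) -` ?E c \<inter> space M" for c
    using measurable_space[OF measurable_phase2] unfolding many_deviating_def by auto
  show "many_deviating c t \<in> M.events"
    unfolding eq by (rule measurable_sets[OF measurable_phase2 b(1)])
  have *: "M.prob (many_deviating c t) = measure ?L (?E c)" for c
    unfolding eq measure_distr[OF measurable_phase2 b(1), symmetric] law_phase2 ..
  show "M.prob (many_deviating 2 t) \<le> ((1 + \<tau> * (z - 1)) / z powr (1/3)) ^ q + (17/18) ^ B2" if "1 \<le> z"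
    using b(2)[OF that] unfolding * \<tau>_def .
  show "M.prob (many_deviating c t) \<le> c * \<tau>"
    using b(3)[OF sizes(4)] unfolding * \<tau>_def .
qed

lemma run_components_in_space:
  assumes x: "x \<in> space M"
  shows "b < B1 \<Longrightarrow> subsample k1 (data x) (draw1 x b) \<in> space (PiM {..<k1} (\<lambda>_. P))"
    and "b < B1 \<Longrightarrow> seed x b \<in> space Q"
    and "b < B2 \<Longrightarrow> subsample k2 (data x) (draw2 x b) \<in> space (PiM {..<k2} (\<lambda>_. P))"
proof -
  have sp: "data x \<in> space (PiM {..<n} (\<lambda>_. P))" "seed x \<in> space (PiM {..<B1} (\<lambda>_. Q))"
    "draw1 x \<in> space (PiM {..<B1} (\<lambda>_. draw k1 D1))" "draw2 x \<in> space (PiM {..<B2} (\<lambda>_. draw k2 D2))"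
    using measurable_space[OF measurable_phase1 x] measurable_space[OF measurable_phase2 x]
    by (auto simp: space_pair_measure)
  have inj: "b < B1 \<Longrightarrow> draw1 x b \<in> injections k1 D1" "b < B2 \<Longrightarrow> draw2 x b \<in> injections k2 D2" for b
    using sp(3,4) by (auto simp: space_PiM space_draw)
  have sub: "subsample k (data x) f \<in> space (PiM {..<k} (\<lambda>_. P))"
    if "f \<in> injections k D" "D \<subseteq> {..<n}" for k f D
    using measurable_space[OF measurable_subsample sp(1)] injections_range[OF that(1)] that(2)
    by blast
  show "b < B1 \<Longrightarrow> subsample k1 (data x) (draw1 x b) \<in> space (PiM {..<k1} (\<lambda>_. P))"
    "b < B2 \<Longrightarrow> subsample k2 (data x) (draw2 x b) \<in> space (PiM {..<k2} (\<lambda>_. P))"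
    using sub inj index_sets by blast+
  show "b < B1 \<Longrightarrow> seed x b \<in> space Q" using sp(2) by (auto simp: space_PiM)
qed

lemma candidates_subset:
  assumes x: "x \<in> space M"
  shows "candidates A k1 B1 (data x) (seed x) (draw1 x) \<subseteq> space Th"
proof -
  have "A k1 (subsample k1 (data x) (draw1 x b)) (seed x b) \<in> space Th" if b: "b < B1" for b
    using measurable_space[OF learner_measurable[OF index_sets(7)],
        of "(subsample k1 (data x) (draw1 x b), seed x b)"] run_components_in_space[OF x] b
    by (simp add: space_pair_measure)
  then show ?thesis unfolding candidates_def by auto
qed

text \<open>
  If some candidate has excess risk at most \<open>\<delta>\<close>, an output with excess risk above \<open>2 \<delta>\<close> is worse
  than this candidate by more than \<open>\<delta>\<close>.
\<close>

lemma bad_output_imp: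
  assumes x: "x \<in> space M" and bad: "min_risk P l (space Th) + 2 * \<delta> < risk P l (out x)"
    and te: "2 * t + eps x \<le> \<delta>"
  shows "2 * t \<le> eps x \<Longrightarrow> x \<in> no_good_candidate \<delta> \<union> many_deviating 2 t"
    and "finite (space Th) \<Longrightarrow> x \<in> no_good_candidate \<delta> \<union> many_deviating (card (space Th)) t"
proof -
  let ?S = "candidates A k1 B1 (data x) (seed x) (draw1 x)"
  let ?W = "card {b \<in> {..<B2}. ereal t < sup_dev P l (space Th) k2 (subsample k2 (data x) (draw2 x b))}"
  have fin: "finite ?S" unfolding candidates_def by simp
  have "{b \<in> {..<B2}. subsample k2 (data x) (draw2 x b) \<in> deviating_sample P Th l k2 t}
      = {b \<in> {..<B2}. ereal t < sup_dev P l (space Th) k2 (subsample k2 (data x) (draw2 x b))}"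
    using run_components_in_space(3)[OF x] unfolding deviating_sample_def by auto
  then have W: "x \<in> many_deviating c t \<longleftrightarrow> B2 \<le> c * ?W" for c
    using x by (simp only: many_deviating_def mem_Collect_eq simp_thms)
  have "B2 \<le> c * ?W \<or> x \<in> no_good_candidate \<delta>"
    if c: "\<And>\<theta>0. \<theta>0 \<in> ?S \<Longrightarrow> risk P l \<theta>0 + \<delta> < risk P l (out x) \<Longrightarrow> B2 \<le> c * ?W" for c
  proof (cases "x \<in> no_good_candidate \<delta>")
    case False
    then obtain b where b: "b < B1"
      "(subsample k1 (data x) (draw1 x b), seed x b) \<notin> failing_sample P Q Th l A k1 \<delta>"
      using x unfolding no_good_candidate_def by auto
    then have "risk P l (A k1 (subsample k1 (data x) (draw1 x b)) (seed x b))
        \<le> min_risk P l (space Th) + \<delta>"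
      using run_components_in_space[OF x] unfolding failing_sample_def by (auto simp: space_pair_measure)
    with bad b(1) have "B2 \<le> c * ?W" by (intro c) (auto simp: candidates_def)
    then show ?thesis ..
  qed simp
  note cases = this
  note win = far_winner_imp_deviating[OF fin candidates_subset[OF x] output_argmax[OF x] _ _ te]
  show "x \<in> no_good_candidate \<delta> \<union> many_deviating 2 t" if "2 * t \<le> eps x"
    using cases[of 2] win(1)[OF _ _ that] unfolding Un_iff W by blast
  show "x \<in> no_good_candidate \<delta> \<union> many_deviating (card (space Th)) t" if "finite (space Th)"
  proof -
    have "B2 \<le> card (space Th) * ?W" if "\<theta>0 \<in> ?S" "risk P l \<theta>0 + \<delta> < risk P l (out x)" for \<theta>0
      using win(2)[OF that threshold_nonneg[OF x]]
        mult_le_mono1[OF card_mono[OF \<open>finite (space Th)\<close> candidates_subset[OF x]], of ?W] by linarith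
    with cases[of "card (space Th)"] show ?thesis unfolding Un_iff W by blast
  qed
qed

end

section \<open>Numerical bounds\<close>

text \<open>
  With \<open>z = 1 / \<tau>\<close> the base is at most \<open>2 * \<tau> powr (1/3)\<close>.  For \<open>y = 1000 * \<tau> < 1\<close> this is
  \<open>y powr (1/3) / 5 \<le> y powr (1/10)\<close>: the constant 1000 absorbs the factor 2, and the exponent
  \<open>1/10\<close> leaves room for \<open>q\<close> being as small as \<open>s / 2\<close>.
\<close>

lemma tail_le_of_small_mean:
  fixes p \<tau> u s :: real and q :: nat
  assumes \<tau>: "0 \<le> \<tau>" "1000 * \<tau> < 1" and u: "1 / 3 \<le> u" and q: "0 < q" "s \<le> 2 * real q"
    and p: "\<And>z. 1 \<le> z \<Longrightarrow> p \<le> ((1 + \<tau> * (z - 1)) / z powr u) ^ q"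
  shows "p \<le> (1000 * \<tau>) powr (s / 20)"
proof (cases "\<tau> = 0")
  case True
  \<comment> \<open>For mean 0 the parameter \<open>z\<close> has no optimal value and tends to infinity.\<close>
  have "p \<le> 1 / w" if w: "1 \<le> w" for w :: real
  proof -
    have w3: "1 \<le> w ^ 3" using w by simp
    have root: "(w ^ 3) powr (1 / 3) = w"
      using w by (simp add: powr_powr flip: powr_numeral)
    have "w \<le> (w ^ 3) powr u"
      using powr_mono[OF u w3] unfolding root .
    then have "1 / (w ^ 3) powr u \<le> 1 / w" "0 \<le> 1 / (w ^ 3) powr u" "1 / w \<le> 1"
      using w by (auto intro!: divide_left_mono mult_pos_pos)
    moreover have "p \<le> (1 / (w ^ 3) powr u) ^ q" using p[OF w3] True by simp
    ultimately show ?thesis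
      using power_decreasing[of 1 q "1 / (w ^ 3) powr u"] q by simp
  qed
  note inv = this
  have "p \<le> 0"
  proof (rule ccontr)
    assume "\<not> p \<le> 0"
    with inv[of 1] inv[of "2 / p"] show False by (simp add: field_simps)
  qed
  then show ?thesis using True by simp
next
  case False
  define y where "y = 1000 * \<tau>"
  have y: "0 < y" "y \<le> 1" "\<tau> = y / 1000" using False \<tau> by (auto simp: y_def)
  have inv: "1 \<le> 1 / \<tau>" using y by simp
  have "(10::real) = 1000 powr (1 / 3)"
    using powr_powr[of 10 3 "1 / 3"] by simp
  moreover have "y powr (1 / 3) = 1000 powr (1 / 3) * \<tau> powr (1 / 3)"
    unfolding y_def by (rule powr_mult)
  ultimately have \<tau>3: "\<tau> powr (1 / 3) = y powr (1 / 3) / 10" by simp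
  have "(1 + \<tau> * (1 / \<tau> - 1)) / (1 / \<tau>) powr u \<le> 2 / (1 / \<tau>) powr (1 / 3)"
    using y \<tau> False by (intro frac_le powr_mono[OF u inv]) (auto simp: algebra_simps)
  also have "\<dots> = y powr (1 / 3) / 5"
    using y \<tau>3 by (simp add: powr_divide)
  also have "\<dots> \<le> y powr (1 / 10)"
    using powr_mono'[of "1 / 10" "1 / 3" y] y powr_ge_zero[of y "1 / 3"] by linarith
  finally have base: "(1 + \<tau> * (1 / \<tau> - 1)) / (1 / \<tau>) powr u \<le> y powr (1 / 10)" .
  have "p \<le> ((1 + \<tau> * (1 / \<tau> - 1)) / (1 / \<tau>) powr u) ^ q" by (rule p[OF inv])
  also have "\<dots> \<le> (y powr (1 / 10)) ^ q"
    using \<tau> False by (intro power_mono base) (auto simp: algebra_simps)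
  also have "\<dots> = y powr (q / 10)"
    using y by (simp add: powr_powr flip: powr_realpow)
  also have "\<dots> \<le> y powr (s / 20)"
    using y q by (intro powr_mono') auto
  finally show ?thesis unfolding y_def .
qed

text \<open>
  Where the minimum is \<open>exp (- 2 / 5)\<close>, the choice \<open>z = 2\<close> suffices: the threshold \<open>1/3\<close> of the
  U-statistic lies above \<open>1/5\<close> far enough that the base is at most \<open>24/25\<close>.
\<close>

lemma phase2_rate:
  fixes p \<tau> s :: real and q :: nat
  assumes \<tau>: "0 \<le> \<tau>" "\<tau> < 1 / 5" and q: "0 < q" "s \<le> 2 * real q"
    and p: "\<And>z. 1 \<le> z \<Longrightarrow> p \<le> ((1 + \<tau> * (z - 1)) / z powr (1 / 3)) ^ q"
  shows "p \<le> min (exp (- 2 / 5)) (1000 * \<tau>) powr (s / 20)"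
proof (cases "exp (- 2 / 5) \<le> 1000 * \<tau>")
  case True
  have "(5 / 4 :: real) = ((5 / 4) ^ 3) powr (1 / 3)"
    by (subst powr_numeral[symmetric]) (simp_all only: powr_powr, simp_all)
  also have "\<dots> \<le> 2 powr (1 / 3)" by (intro powr_mono2) (auto simp: power3_eq_cube)
  finally have "(1 + \<tau>) / 2 powr (1 / 3) \<le> (6 / 5) / (5 / 4)"
    using \<tau> by (intro frac_le) auto
  also have "\<dots> \<le> exp (- 1 / 25)" using exp_ge_add_one_self[of "- 1 / 25"] by simp
  finally have base: "(1 + \<tau>) / 2 powr (1 / 3) \<le> exp (- 1 / 25)" .
  have "p \<le> ((1 + \<tau>) / 2 powr (1 / 3)) ^ q" using p[of 2] by simp
  also have "\<dots> \<le> exp (- 1 / 25) ^ q" using \<tau> by (intro power_mono base) auto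
  also have "\<dots> = exp (- real q / 25)" by (simp add: exp_of_nat_mult[symmetric])
  also have "\<dots> \<le> exp (- 2 / 5 * (s / 20))" using q by simp
  also have "\<dots> = min (exp (- 2 / 5)) (1000 * \<tau>) powr (s / 20)"
    using True by (simp add: min_def powr_def mult.commute)
  finally show ?thesis .
next
  case False
  have "exp (- 2 / 5 :: real) \<le> 1" by simp
  with False have "1000 * \<tau> < 1" by linarith
  from tail_le_of_small_mean[OF \<tau>(1) this _ q p] False show ?thesis by (simp add: min_def)
qed

text \<open>
  The threshold \<open>(1 + E) / 2\<close> lies halfway between \<open>E\<close> and 1, which makes the exponent proportional
  to \<open>1 - E\<close>, with the factor \<open>(1 - ln 2) / 2 \<ge> 3 / 20\<close>.
\<close>

lemma phase1_base_le:
  fixes E :: real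
  assumes E: "0 \<le> E" "E \<le> 1"
  shows "(1 + E) / 2 powr ((1 + E) / 2) \<le> exp (- (3 / 20) * (1 - E))"
proof -
  have two_powr: "2 powr ((1 + E) / 2) = exp ((1 + E) / 2 * ln 2)" by (simp add: powr_def)
  have "1 + E \<le> 2 * exp (- (1 - E) / 2)"
    using exp_ge_add_one_self[of "- (1 - E) / 2"] by argo
  also have "\<dots> = exp (ln 2) * exp (- (1 - E) / 2)" by simp
  also have "\<dots> = exp (ln 2 + - (1 - E) / 2)" by (simp only: exp_add)
  finally have "(1 + E) / 2 powr ((1 + E) / 2) \<le> exp (ln 2 + - (1 - E) / 2) / exp ((1 + E) / 2 * ln 2)"
    unfolding two_powr by (intro divide_right_mono) auto
  also have "\<dots> = exp (- ((1 - ln 2) / 2) * (1 - E))"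
    unfolding exp_diff[symmetric] by (simp add: field_simps)
  also have "\<dots> \<le> exp (- (3 / 20) * (1 - E))"
    using ln2_le_25_over_36 E by (intro exp_le_cancel_iff[THEN iffD2] mult_right_mono) auto
  finally show ?thesis .
qed

lemma phase1_rate:
  fixes p E s :: real and q :: nat
  assumes E: "0 \<le> E" "E \<le> 1" and q: "0 < q" "s \<le> 2 * real q"
    and p: "\<And>z. 1 \<le> z \<Longrightarrow> p \<le> ((1 + E * (z - 1)) / z powr ((1 + E) / 2)) ^ q"
  shows "p \<le> min (exp (- (1 - E))) (1000 * E) powr (s / 20)"
proof (cases "exp (- (1 - E)) \<le> 1000 * E")
  case True
  have "p \<le> ((1 + E) / 2 powr ((1 + E) / 2)) ^ q" using p[of 2] by simp
  also have "\<dots> \<le> exp (- (3 / 20) * (1 - E)) ^ q" using E by (intro power_mono phase1_base_le) auto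
  also have "\<dots> = exp (- (1 - E) * (3 * q / 20))" by (subst exp_of_nat_mult[symmetric]) (simp add: field_simps)
  also have "\<dots> \<le> exp (- (1 - E) * (s / 20))"
    using E q by (intro exp_le_cancel_iff[THEN iffD2] mult_left_mono_neg) auto
  also have "\<dots> = min (exp (- (1 - E))) (1000 * E) powr (s / 20)"
    using True by (simp add: min_def powr_def mult.commute)
  finally show ?thesis .
next
  case False
  have "exp (- (1 - E)) \<le> 1" using E by simp
  with False have "1000 * E < 1" by linarith
  from tail_le_of_small_mean[OF E(1) this _ q p] E False show ?thesis by (simp add: min_def)
qed

lemma half_power_le:
  fixes E :: real
  assumes "0 \<le> E"
  shows "((1 + E) / 2) ^ B \<le> exp (- real B * (1 - E) / 2)"
proof -
  have "((1 + E) / 2) ^ B \<le> exp (- (1 - E) / 2) ^ B"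
    using exp_ge_add_one_self[of "- (1 - E) / 2"] assms by (intro power_mono) (auto simp: field_simps)
  also have "\<dots> = exp (- real B * (1 - E) / 2)"
    by (subst exp_of_nat_mult[symmetric]) (simp add: field_simps)
  finally show ?thesis .
qed

text \<open>
  Rounding down to a whole number of blocks costs at most a factor 2, because there is at least one
  block.
\<close>

lemma block_count:
  assumes "0 < k" "2 * k \<le> n"
  shows "0 < n div (2 * k)" "n div (2 * k) * k \<le> n div 2" "real n / (2 * real k) \<le> 2 * real (n div (2 * k))"
proof -
  show 1: "0 < n div (2 * k)" using assms by (simp add: div_greater_zero_iff)
  show "n div (2 * k) * k \<le> n div 2"
    by (simp add: div_mult2_eq)
  have "n < 2 * k + n div (2 * k) * (2 * k)"
    by (rule dividend_less_div_times) (use assms in simp)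
  also have "\<dots> \<le> n div (2 * k) * (2 * k) + n div (2 * k) * (2 * k)"
    using mult_le_mono1[of 1 "n div (2 * k)" "2 * k"] 1 by simp
  also have "\<dots> = 2 * (n div (2 * k)) * (2 * k)" by simp
  finally have "real n \<le> real (2 * (n div (2 * k)) * (2 * k))"
    by (intro of_nat_mono less_imp_le)
  then show "real n / (2 * real k) \<le> 2 * real (n div (2 * k))"
    using assms(1) by (simp add: divide_le_eq del: of_nat_div)
qed

section \<open>Tail bounds for the output\<close>

lemma excess_tail_bounds:
  assumes "prob_space P" "prob_space Q"
  shows "0 \<le> excess_tail P l \<Theta> Q A k \<delta>" "excess_tail P l \<Theta> Q A k \<delta> \<le> 1"
proof -
  interpret prob_space "PiM {..<k} (\<lambda>_. P) \<Otimes>\<^sub>M Q"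
    using assms by (intro prob_space_pair prob_space_PiM)
  show "0 \<le> excess_tail P l \<Theta> Q A k \<delta>" "excess_tail P l \<Theta> Q A k \<delta> \<le> 1"
    unfolding excess_tail_def by auto
qed

context rove_run
begin

text \<open>\<open>G\<close> stands for the event that the threshold leaves its prescribed range.\<close>

lemma output_tail_split:
  assumes dev: "sup_dev P l (space Th) k2 \<in> borel_measurable (PiM {..<k2} (\<lambda>_. P))"
    and G: "G \<in> M.events"
    and bad: "\<And>x. x \<in> space M \<Longrightarrow> x \<notin> G \<Longrightarrow> min_risk P l (space Th) + 2 * \<delta> < risk P l (out x) \<Longrightarrow>
      x \<in> no_good_candidate \<delta> \<union> many_deviating c t"
  shows "\<P>(x in M. risk P l (out x) > min_risk P l (space Th) + 2 * \<delta>)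
    \<le> M.prob (no_good_candidate \<delta>) + M.prob (many_deviating c t) + M.prob G"
proof -
  have [simp]: "no_good_candidate \<delta> \<in> M.events"
    using prob_no_good_candidate(1)[of 1 1 1] index_sets by simp
  have [simp]: "many_deviating c t \<in> M.events"
    using prob_many_deviating(1)[of 1] index_sets dev by simp
  have "\<P>(x in M. risk P l (out x) > min_risk P l (space Th) + 2 * \<delta>)
      \<le> M.prob ((no_good_candidate \<delta> \<union> many_deviating c t) \<union> G)"
    using bad G by (intro M.finite_measure_mono sets.Un) auto
  also have "\<dots> \<le> M.prob (no_good_candidate \<delta> \<union> many_deviating c t) + M.prob G"
    using G by (intro measure_Un_le) auto
  also have "\<dots> \<le> M.prob (no_good_candidate \<delta>) + M.prob (many_deviating c t) + M.prob G"
    by (intro add_right_mono measure_Un_le) auto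
  finally show ?thesis .
qed

text \<open>
  The choice of \<open>t\<close> makes both conditions of \<open>bad_output_imp\<close> hold for every threshold in
  \<open>[el, eu]\<close>.  Since \<open>t\<close> is one of \<open>(\<delta> - eu) / 2\<close> and \<open>el / 2\<close>, its tail is below \<open>1 / 5\<close>, which
  is less than the level \<open>1 / 3\<close> that the U-statistic has to reach.
\<close>

lemma roves_tail:
  assumes sp: "sp" and dev: "sup_dev P l (space Th) k2 \<in> borel_measurable (PiM {..<k2} (\<lambda>_. P))"
    and el: "0 < el" "el \<le> eu" "eu < \<delta>"
    and eps: "\<P>(x in M. eps x \<in> {el..eu}) = 1"
    and small: "dev_tail P l (space Th) k2 ((\<delta> - eu) / 2) + dev_tail P l (space Th) k2 (el / 2) < 1 / 5"
  shows "\<P>(x in M. risk P l (out x) > min_risk P l (space Th) + 2 * \<delta>)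
    \<le> roves_bound 1000 20 18 1 1000 20 2 n k1 k2 B1 B2
        (excess_tail P l (space Th) Q A k1 \<delta>) (dev_tail P l (space Th) k2 (min el (\<delta> - eu) / 2))"
proof -
  define E where "E = excess_tail P l (space Th) Q A k1 \<delta>"
  define t where "t = min el (\<delta> - eu) / 2"
  define \<tau> where "\<tau> = dev_tail P l (space Th) k2 t"
  have E: "0 \<le> E" "E \<le> 1"
    unfolding E_def using excess_tail_bounds P.prob_space_axioms Q.prob_space_axioms by blast+
  have dev0: "0 \<le> dev_tail P l (space Th) k2 r" for r
    unfolding dev_tail_def by simp
  have \<tau>: "0 \<le> \<tau>" "\<tau> < 1 / 5"
    using small dev0[of "(\<delta> - eu) / 2"] dev0[of "el / 2"] unfolding \<tau>_def t_def
    by (auto simp: min_def)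
  have card: "card D1 = n div 2" "n div 2 \<le> card D2" and k: "2 * k1 \<le> n" "2 * k2 \<le> n"
    using sp sizes(1,2) by (auto simp: phase1_idx_def phase2_idx_def subsample_size_ok_def)
  define q1 where "q1 = n div (2 * k1)"
  define q2 where "q2 = n div (2 * k2)"
  have q1: "0 < q1" "q1 * k1 \<le> card D1" "real n / (2 * real k1) \<le> 2 * real q1"
    using block_count[OF index_sets(7) k(1)] card unfolding q1_def by auto
  have q2: "0 < q2" "q2 * k2 \<le> card D2" "real n / (2 * real k2) \<le> 2 * real q2"
    using block_count[OF index_sets(8) k(2)] card unfolding q2_def by auto
  let ?G = "{x \<in> space M. eps x \<notin> {el..eu}}"
  have G: "?G \<in> M.events" using threshold_measurable by measurable
  have "{x \<in> space M. eps x \<in> {el..eu}} \<in> M.events" using threshold_measurable by measurable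
  then have "M.prob ?G = 0"
    using M.prob_neg[of "\<lambda>x. eps x \<in> {el..eu}"] eps by simp
  have "\<P>(x in M. risk P l (out x) > min_risk P l (space Th) + 2 * \<delta>)
    \<le> M.prob (no_good_candidate \<delta>) + M.prob (many_deviating 2 t) + M.prob ?G"
  proof (rule output_tail_split[OF dev G])
    fix x assume x: "x \<in> space M" "x \<notin> ?G"
      and bad: "min_risk P l (space Th) + 2 * \<delta> < risk P l (out x)"
    have "2 * t + eps x \<le> \<delta>" "2 * t \<le> eps x" using x unfolding t_def by (auto simp: min_def)
    from bad_output_imp(1)[OF x(1) bad this] show "x \<in> no_good_candidate \<delta> \<union> many_deviating 2 t" .
  qed
  also have "\<dots> = M.prob (no_good_candidate \<delta>) + M.prob (many_deviating 2 t)"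
    using \<open>M.prob ?G = 0\<close> by simp
  also have "M.prob (no_good_candidate \<delta>)
      \<le> min (exp (- (1 - E))) (1000 * E) powr (real n / (2 * real k1) / 20) + exp (- real B1 * (1 - E) / 2)"
  proof -
    have "M.prob (no_good_candidate \<delta>) - ((1 + E) / 2) ^ B1
        \<le> min (exp (- (1 - E))) (1000 * E) powr (real n / (2 * real k1) / 20)"
    proof (rule phase1_rate[OF E q1(1,3)])
      fix z :: real assume z: "1 \<le> z"
      show "M.prob (no_good_candidate \<delta>) - ((1 + E) / 2) ^ B1
          \<le> ((1 + E * (z - 1)) / z powr ((1 + E) / 2)) ^ q1"
        using prob_no_good_candidate(2)[OF q1(1,2) z, of "(1 + E) / 2" \<delta>] E unfolding E_def by simp
    qed
    then show ?thesis using half_power_le[OF E(1), of B1] by linarith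
  qed
  also have "M.prob (many_deviating 2 t)
      \<le> min (exp (- 2 / 5)) (1000 * \<tau>) powr (real n / (2 * real k2) / 20) + exp (- real B2 / 18)"
  proof -
    have "M.prob (many_deviating 2 t) - (17 / 18) ^ B2
        \<le> min (exp (- 2 / 5)) (1000 * \<tau>) powr (real n / (2 * real k2) / 20)"
    proof (rule phase2_rate[OF \<tau> q2(1,3)])
      fix z :: real assume z: "1 \<le> z"
      show "M.prob (many_deviating 2 t) - (17 / 18) ^ B2 \<le> ((1 + \<tau> * (z - 1)) / z powr (1 / 3)) ^ q2"
        using prob_many_deviating(2)[OF q2(1,2) dev z, of t] unfolding \<tau>_def by simp
    qed
    moreover have "(17 / 18 :: real) ^ B2 \<le> exp (- real B2 / 18)"
    proof -
      have "(17 / 18 :: real) ^ B2 \<le> exp (- 1 / 18) ^ B2"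
        using exp_ge_add_one_self[of "- 1 / 18"] by (intro power_mono) auto
      then show ?thesis by (simp add: exp_of_nat_mult[symmetric])
    qed
    ultimately show ?thesis by linarith
  qed
  finally have "\<P>(x in M. risk P l (out x) > min_risk P l (space Th) + 2 * \<delta>)
      \<le> (min (exp (- 2 / 5)) (1000 * \<tau>) powr (real n / (2 * real k2) / 20) + exp (- real B2 / 18))
        + min (exp (- (1 - E))) (1000 * E) powr (real n / (2 * real k1) / 20) + exp (- real B1 * (1 - E) / 2)"
    by simp
  also have "min (exp (- 2 / 5)) (1000 * \<tau>) powr (real n / (2 * real k2) / 20) + exp (- real B2 / 18)
      \<le> real B1 * (3 * min (exp (- 2 / 5)) (1000 * \<tau>) powr (real n / (2 * real k2) / 20) + exp (- real B2 / 18))"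
  proof -
    have "X + Y \<le> 3 * X + Y" "0 \<le> 3 * X + Y" if "0 \<le> X" "0 \<le> Y" for X Y :: real
      using that by auto
    moreover have "1 \<le> real B1" using sizes(3) by simp
    ultimately show ?thesis
      by (meson exp_ge_zero mult_le_cancel_right1 mult_right_mono order_trans powr_ge_zero mult_1 le_numeral_extra(4))
  qed
  finally show ?thesis
    unfolding roves_bound_def E_def[symmetric] t_def[symmetric] \<tau>_def[symmetric]
    by (simp add: mult_ac)
qed

lemma rove_tail:
  fixes q :: nat and \<delta> :: real
  assumes fin: "finite (space Th)" and q: "0 < q" "q * k1 \<le> card D1"
  defines "E \<equiv> excess_tail P l (space Th) Q A k1 \<delta>"
  shows "\<P>(x in M. risk P l (out x) > min_risk P l (space Th) + 2 * \<delta>)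
    \<le> exp (- (3 / 20) * (1 - E)) ^ q + exp (- real B1 * (1 - E) / 2)
      + card (space Th) * dev_tail P l (space Th) k2 (\<delta> / 4) + \<P>(x in M. eps x > \<delta> / 2)"
proof -
  note dev = measurable_sup_dev_finite[OF fin, of k2]
  have E: "0 \<le> E" "E \<le> 1"
    unfolding E_def using excess_tail_bounds P.prob_space_axioms Q.prob_space_axioms by blast+
  let ?G = "{x \<in> space M. eps x > \<delta> / 2}"
  have G: "?G \<in> M.events" using threshold_measurable by measurable
  have "\<P>(x in M. risk P l (out x) > min_risk P l (space Th) + 2 * \<delta>)
    \<le> M.prob (no_good_candidate \<delta>) + M.prob (many_deviating (card (space Th)) (\<delta> / 4)) + M.prob ?G"
  proof (rule output_tail_split[OF dev G])
    fix x assume x: "x \<in> space M" "x \<notin> ?G"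
      and bad: "min_risk P l (space Th) + 2 * \<delta> < risk P l (out x)"
    have "2 * (\<delta> / 4) + eps x \<le> \<delta>" using x by simp
    from bad_output_imp(2)[OF x(1) bad this fin]
    show "x \<in> no_good_candidate \<delta> \<union> many_deviating (card (space Th)) (\<delta> / 4)" .
  qed
  moreover have "M.prob (no_good_candidate \<delta>)
      \<le> exp (- (3 / 20) * (1 - E)) ^ q + exp (- real B1 * (1 - E) / 2)"
  proof -
    have "M.prob (no_good_candidate \<delta>) \<le> ((1 + E) / 2 powr ((1 + E) / 2)) ^ q + ((1 + E) / 2) ^ B1"
      using prob_no_good_candidate(2)[OF q, of 2 "(1 + E) / 2" \<delta>] E unfolding E_def by simp
    moreover have "((1 + E) / 2 powr ((1 + E) / 2)) ^ q \<le> exp (- (3 / 20) * (1 - E)) ^ q"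
      using E by (intro power_mono phase1_base_le) auto
    ultimately show ?thesis using half_power_le[OF E(1), of B1] by linarith
  qed
  moreover have "M.prob (many_deviating (card (space Th)) (\<delta> / 4))
      \<le> card (space Th) * dev_tail P l (space Th) k2 (\<delta> / 4)"
    using prob_many_deviating(3)[of 1] index_sets dev by simp
  ultimately show ?thesis by linarith
qed

end

section \<open>The limit for finite parameter spaces\<close>

text \<open>
  Along the sequence \<open>E\<close> stays below some \<open>c < 1\<close>, so every term of \<open>rove_tail\<close> is dominated by
  one that tends to 0.
\<close>

lemma rove_consistent:
  fixes P :: "'z measure" and Q :: "'w measure" and Th :: "'t measure" and M :: "nat \<Rightarrow> 'm measure"
    and k1 k2 B1 B2 :: "nat \<Rightarrow> nat" and \<delta> :: real
  assumes setting: "learning_setting P Q Th l A" and fin: "finite (space Th)"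
    and dev: "\<And>t. 0 < t \<Longrightarrow> (\<lambda>k. dev_tail P l (space Th) k t) \<longlonglongrightarrow> 0" and \<delta>: "0 < \<delta>"
    and run: "\<forall>\<^sub>F n in sequentially.
      rove_run P Q Th l A (M n) False n (k1 n) (k2 n) (B1 n) (B2 n)
        (data n) (seed n) (draw1 n) (draw2 n) (eps n) (out n)"
    and E: "limsup (\<lambda>k. ereal (excess_tail P l (space Th) Q A k \<delta>)) < 1"
    and eps: "(\<lambda>n. \<P>(x in M n. eps n x > \<delta> / 2)) \<longlonglongrightarrow> 0"
    and k1: "filterlim k1 at_top sequentially" "filterlim (\<lambda>n. real n / real (k1 n)) at_top sequentially"
    and k2: "filterlim k2 at_top sequentially"
    and B1: "filterlim B1 at_top sequentially"
  shows "(\<lambda>n. \<P>(x in M n. risk P l (out n x) > min_risk P l (space Th) + 2 * \<delta>)) \<longlonglongrightarrow> 0"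
proof -
  let ?E = "\<lambda>k. excess_tail P l (space Th) Q A k \<delta>"
  obtain c where c: "limsup (\<lambda>k. ereal (?E k)) < ereal c" "c < 1"
    using ereal_dense2[OF E] by (auto simp: one_ereal_def)
  have "\<forall>\<^sub>F k in sequentially. ?E k < c"
    using Limsup_lessD[OF c(1)] by simp
  then have Ec: "\<forall>\<^sub>F n in sequentially. ?E (k1 n) < c"
    using k1(1) by (rule eventually_compose_filterlim)
  let ?f = "\<lambda>n. exp (- (3 / 20) * (1 - c)) ^ (n div k1 n) + exp (- (1 - c) / 2) ^ B1 n
      + card (space Th) * dev_tail P l (space Th) (k2 n) (\<delta> / 4) + \<P>(x in M n. eps n x > \<delta> / 2)"
  have q: "filterlim (\<lambda>n. n div k1 n) at_top sequentially"
    unfolding filterlim_sequentially_iff_filterlim_real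
  proof (rule filterlim_at_top_mono)
    show "filterlim (\<lambda>n. - 1 + real n / real (k1 n)) at_top sequentially"
      using k1(2) by (intro filterlim_tendsto_add_at_top[OF tendsto_const])
    show "\<forall>\<^sub>F n in sequentially. - 1 + real n / real (k1 n) \<le> real (n div k1 n)"
    proof (intro always_eventually allI)
      fix n
      have "real (n div k1 n) = of_int \<lfloor>real n / real (k1 n)\<rfloor>"
        by (simp add: floor_divide_of_nat_eq)
      then show "- 1 + real n / real (k1 n) \<le> real (n div k1 n)" by linarith
    qed
  qed
  have lim: "?f \<longlonglongrightarrow> 0 + 0 + real (card (space Th)) * 0 + 0"
  proof (intro tendsto_add tendsto_mult tendsto_const eps)
    have "(\<lambda>j. exp (- (3 / 20) * (1 - c)) ^ j) \<longlonglongrightarrow> 0"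
      using c(2) by (intro LIMSEQ_realpow_zero) auto
    then show "(\<lambda>n. exp (- (3 / 20) * (1 - c)) ^ (n div k1 n)) \<longlonglongrightarrow> 0"
      using q by (rule filterlim_compose)
    have "(\<lambda>j. exp (- (1 - c) / 2) ^ j) \<longlonglongrightarrow> 0"
      using c(2) by (intro LIMSEQ_realpow_zero) auto
    then show "(\<lambda>n. exp (- (1 - c) / 2) ^ B1 n) \<longlonglongrightarrow> 0"
      using B1 by (rule filterlim_compose)
    show "(\<lambda>n. dev_tail P l (space Th) (k2 n) (\<delta> / 4)) \<longlonglongrightarrow> 0"
      using dev[of "\<delta> / 4"] \<delta> k2 by (intro filterlim_compose[OF _ k2]) auto
  qed
  show ?thesis
  proof (rule tendsto_sandwich[of "\<lambda>_. 0" _ _ ?f])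
    show "\<forall>\<^sub>F n in sequentially. \<P>(x in M n. risk P l (out n x) > min_risk P l (space Th) + 2 * \<delta>) \<le> ?f n"
      using run Ec
    proof eventually_elim
      case (elim n)
      interpret rove_run P Q Th l A "M n" False n "k1 n" "k2 n" "B1 n" "B2 n"
        "data n" "seed n" "draw1 n" "draw2 n" "eps n" "out n" by (rule elim(1))
      have q: "0 < n div k1 n" "n div k1 n * k1 n \<le> card (phase1_idx False n)"
        using sizes(1) by (auto simp: subsample_size_ok_def phase1_idx_def div_greater_zero_iff)
      have "exp (- (3 / 20) * (1 - ?E (k1 n))) ^ (n div k1 n) \<le> exp (- (3 / 20) * (1 - c)) ^ (n div k1 n)"
        using elim(2) by (intro power_mono) auto
      moreover have "exp (- real (B1 n) * (1 - ?E (k1 n)) / 2) \<le> exp (- (1 - c) / 2) ^ B1 n"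
      proof -
        have "real (B1 n) * (1 - c) \<le> real (B1 n) * (1 - ?E (k1 n))"
          using elim(2) by (intro mult_left_mono) auto
        then show ?thesis by (subst exp_of_nat_mult[symmetric]) (simp add: field_simps)
      qed
      ultimately show ?case using rove_tail[OF fin q, of \<delta>] by linarith
    qed
  qed (use lim in auto)
qed

theorem theoremB11:
  shows
    "(\<exists>C1 C2 C3 C4 C5 C6 C7 :: real.
        universal_constants {C1, C2, C3, C4, C5, C6, C7} \<and>
        (\<forall>(P :: 'z measure) (Q :: 'w measure) (Th :: 't measure) l A
           (M :: 'm measure) n k1 k2 B1 B2 data seed draw1 draw2 eps out
           (\<delta> :: real) (el :: real) (eu :: real).
           rove_run P Q Th l A M True n k1 k2 B1 B2 data seed draw1 draw2 eps out \<longrightarrow>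
           sup_dev P l (space Th) k2 \<in> borel_measurable (PiM {..<k2} (\<lambda>_. P)) \<longrightarrow>
           0 < \<delta> \<longrightarrow> 0 < el \<longrightarrow> el \<le> eu \<longrightarrow> eu < \<delta> \<longrightarrow>
           \<P>(x in M. eps x \<in> {el..eu}) = 1 \<longrightarrow>
           dev_tail P l (space Th) k2 ((\<delta> - eu) / 2) + dev_tail P l (space Th) k2 (el / 2)
             < 1 / 5 \<longrightarrow>
           \<P>(x in M. risk P l (out x) > min_risk P l (space Th) + 2 * \<delta>)
             \<le> roves_bound C1 C2 C3 C4 C5 C6 C7 n k1 k2 B1 B2
                  (excess_tail P l (space Th) Q A k1 \<delta>)
                  (dev_tail P l (space Th) k2 (min el (\<delta> - eu) / 2))))
     \<and>
     (\<forall>(P :: 'z measure) (Q :: 'w measure) (Th :: 't measure) l A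
        (M :: nat \<Rightarrow> 'm measure) k1 k2 B1 B2 data seed draw1 draw2 eps out (\<delta> :: real).
        learning_setting P Q Th l A \<longrightarrow>
        finite (space Th) \<longrightarrow>
        (\<forall>t>0. (\<lambda>k. dev_tail P l (space Th) k t) \<longlonglongrightarrow> 0) \<longrightarrow>
        0 < \<delta> \<longrightarrow>
        (\<forall>\<^sub>F n in sequentially.
           rove_run P Q Th l A (M n) False n (k1 n) (k2 n) (B1 n) (B2 n)
             (data n) (seed n) (draw1 n) (draw2 n) (eps n) (out n)) \<longrightarrow>
        limsup (\<lambda>k. ereal (excess_tail P l (space Th) Q A k \<delta>)) < 1 \<longrightarrow>
        (\<lambda>n. \<P>(x in M n. eps n x > \<delta> / 2)) \<longlonglongrightarrow> 0 \<longrightarrow>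
        filterlim k1 at_top sequentially \<longrightarrow>
        filterlim k2 at_top sequentially \<longrightarrow>
        filterlim (\<lambda>n. real n / real (k1 n)) at_top sequentially \<longrightarrow>
        filterlim (\<lambda>n. real n / real (k2 n)) at_top sequentially \<longrightarrow>
        filterlim B1 at_top sequentially \<longrightarrow>
        filterlim B2 at_top sequentially \<longrightarrow>
        (\<lambda>n. \<P>(x in M n. risk P l (out n x) > min_risk P l (space Th) + 2 * \<delta>))
          \<longlonglongrightarrow> 0)"
proof (intro conjI, goal_cases)
  case 1
  show ?case
  proof (rule exI[of _ 1000], rule exI[of _ 20], rule exI[of _ 18], rule exI[of _ 1],
      rule exI[of _ 1000], rule exI[of _ 20], rule exI[of _ 2], intro conjI allI impI)
    show "universal_constants {1000, 20, 18, 1, 1000, 20, 2}"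
      unfolding universal_constants_def by simp
  qed (rule rove_run.roves_tail[where sp=True, OF _ TrueI])
next
  case 2
  show ?case
    by (intro allI impI, rule rove_consistent) blast+
qed

end
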